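(* Suppose there exists an integer $d\ge 3$ with the following property: for every integer $p\ge 1$ there exists an integer $k_0(d,p)$ such that for all $k\ge k_0(d,p)$ the constant function $\mathbf{1}$ on $\mathcal{C}_k^{(d)}$ lies in the linear span $\mathrm{span}\{\mathbf{1}_{\mathcal{S}} : \mathcal{S} \text{ is a length-}p\text{ shuffle class in } \mathcal{C}_k^{(d)}\}$ (i.e. there are real numbers $\lambda_{\mathcal{S}}$ with $\sum_{\mathcal{S}}\lambda_{\mathcal{S}}\mathbf{1}_{\mathcal{S}}(T)=1$ for every $T\in\mathcal{C}_k^{(d)}$). Then the Jacobian conjecture holds: for every $n\ge 1$, every Keller map $F:\mathbb{C}^n\to\mathbb{C}^n$ is a polynomial automorphism.
   Context: For an integer $d\ge 2$, a $d$-Catalan tree is a rooted planar tree (children of each vertex ordered left to right) in which every vertex has either $0$ or $d$ children; vertices with $d$ children are internal, the others are leaves. $\mathcal{C}_k^{(d)}$ denotes the set of $d$-Catalan trees with $k$ internal vertices. An (ancestral) path of length $p$ is a sequence of vertices $(v_0,\dots,v_p)$ with $v_i$ a child of $v_{i-1}$. For $1\le i\le p$, $v_i$ has $d-1$ siblings $w_{i,1},\dots,w_{i,d-1}$, each subtending a subtree $W_{i,j}$ (the vertex $w_{i,j}$ and all its descendants). The shuffle class $\mathrm{Sh}(T;v_0,\dots,v_p)\subseteq\mathcal{C}_k^{(d)}$ of $T\in\mathcal{C}_k^{(d)}$ is the set of all trees obtainable from $T$ by rearranging the $(d-1)p$ subtrees $W_{i,j}$ among the $(d-1)p$ sibling positions,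 keeping everything else fixed. A length-$p$ shuffle class in $\mathcal{C}_k^{(d)}$ is any set of this form; $\mathbf{1}_{\mathcal{S}}$ is its indicator function on $\mathcal{C}_k^{(d)}$. A polynomial mapping $F=(F_1,\dots,F_n):\mathbb{C}^n\to\mathbb{C}^n$ (each $F_i\in\mathbb{C}[X_1,\dots,X_n]$) is a Keller map if $\det JF$, where $(JF)_{i,j}=\partial F_i/\partial X_j$, is a nonzero constant; it is a polynomial automorphism if there is a polynomial mapping $G$ with $F\circ G=G\circ F=\mathrm{id}$. *)

theory Defs
  imports "HOL-Analysis.Analysis"
begin

datatype ptree = Nd "ptree list"

fun is_catalan :: "nat \<Rightarrow> ptree \<Rightarrow> bool" where
  "is_catalan d (Nd ts) = ((ts = [] \<or> length ts = d) \<and> (\<forall>t\<in>set ts. is_catalan d t))"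

fun internal_count :: "ptree \<Rightarrow> nat" where
  "internal_count (Nd ts) = (if ts = [] then 0 else 1) + sum_list (map internal_count ts)"

definition catalan_trees :: "nat \<Rightarrow> nat \<Rightarrow> ptree set" where
  "catalan_trees d k = {T. is_catalan d T \<and> internal_count T = k}"

text \<open>Vertices are addressed by the list of child indices from the root.\<close>
fun is_addr :: "ptree \<Rightarrow> nat list \<Rightarrow> bool" where
  "is_addr t [] = True"
| "is_addr (Nd ts) (i # is) = (i < length ts \<and> is_addr (ts ! i) is)"

fun subtree_at :: "ptree \<Rightarrow> nat list \<Rightarrow> ptree" where
  "subtree_at t [] = t"
| "subtree_at (Nd ts) (i # is) = subtree_at (ts ! i) is"

function graft :: "(nat list \<Rightarrow> ptree option) \<Rightarrow> nat list \<Rightarrow> ptree \<Rightarrow> ptree" where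
  "graft f a (Nd ts) = (case f a of Some s \<Rightarrow> s
     | None \<Rightarrow> Nd (map (\<lambda>i. graft f (a @ [i]) (ts ! i)) [0..<length ts]))"
  by pat_completeness auto
termination
  by (relation "Wellfounded.measure (\<lambda>(f, a, t). size t)")
     (auto intro!: le_imp_less_Suc size_list_estimation'[OF nth_mem])

text \<open>For the path (v_0, ..., v_p) with v_0 = v0 and v_i = v0 @ take i cs,
  the sibling positions of v_1, ..., v_p.\<close>
definition sibling_positions :: "nat \<Rightarrow> nat list \<Rightarrow> nat list \<Rightarrow> nat list set" where
  "sibling_positions d v0 cs =
     {v0 @ take i cs @ [j] | i j. i < length cs \<and> j < d \<and> j \<noteq> cs ! i}"

definition shuffle_class :: "nat \<Rightarrow> ptree \<Rightarrow> nat list \<Rightarrow> nat list \<Rightarrow> ptree set" where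
  "shuffle_class d T v0 cs =
     {graft (\<lambda>b. if b \<in> sibling_positions d v0 cs then Some (subtree_at T (\<sigma> b)) else None) [] T
      | \<sigma>. bij_betw \<sigma> (sibling_positions d v0 cs) (sibling_positions d v0 cs)}"

definition shuffle_classes :: "nat \<Rightarrow> nat \<Rightarrow> nat \<Rightarrow> ptree set set" where
  "shuffle_classes d k p =
     {shuffle_class d T v0 cs | T v0 cs.
        T \<in> catalan_trees d k \<and> length cs = p \<and> is_addr T (v0 @ cs)}"

definition one_in_shuffle_span :: "nat \<Rightarrow> nat \<Rightarrow> nat \<Rightarrow> bool" where
  "one_in_shuffle_span d k p =
     (\<exists>lam :: ptree set \<Rightarrow> real. \<forall>T \<in> catalan_trees d k.
        (\<Sum>S \<in> shuffle_classes d k p. lam S * indicator S T) = 1)"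

definition cpoly_fun :: "(complex ^ 'n \<Rightarrow> complex) \<Rightarrow> bool" where
  "cpoly_fun f = (\<exists>A :: (nat ^ 'n) set. \<exists>c :: nat ^ 'n \<Rightarrow> complex. finite A \<and>
      (\<forall>x. f x = (\<Sum>\<alpha>\<in>A. c \<alpha> * (\<Prod>i\<in>UNIV. (x $ i) ^ (\<alpha> $ i)))))"

definition poly_map :: "(complex ^ 'n \<Rightarrow> complex ^ 'n) \<Rightarrow> bool" where
  "poly_map F = (\<forall>i. cpoly_fun (\<lambda>x. F x $ i))"

definition jacobian :: "(complex ^ 'n \<Rightarrow> complex ^ 'n) \<Rightarrow> complex ^ 'n \<Rightarrow> complex ^ 'n ^ 'n" where
  "jacobian F x = (\<chi> i j. deriv (\<lambda>t. F (\<chi> k. if k = j then t else x $ k) $ i) (x $ j))"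

definition keller_map :: "(complex ^ 'n \<Rightarrow> complex ^ 'n) \<Rightarrow> bool" where
  "keller_map F = (poly_map F \<and> (\<exists>c. c \<noteq> 0 \<and> (\<forall>x. det (jacobian F x) = c)))"

definition poly_automorphism :: "(complex ^ 'n \<Rightarrow> complex ^ 'n) \<Rightarrow> bool" where
  "poly_automorphism F = (poly_map F \<and> (\<exists>G. poly_map G \<and> F \<circ> G = id \<and> G \<circ> F = id))"

end

theory Submission
  imports Defs "HOL-Library.Function_Algebras"
    "HOL-Computational_Algebra.Fundamental_Theorem_Algebra"
begin

text \<open>
  It suffices to find a polynomial right inverse for every Keller map: a right inverse \<open>G\<close> of \<open>F\<close> is
  again Keller, so it has a right inverse in turn, which must be \<open>F\<close>.

  After an affine normalisation, \<open>F\<close> is the identity plus monomials of degree at least two.  Adding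
  variables and composing with elementary automorphisms (Bass, Connell and Wright) lowers all degrees to
  at most three.  One further variable \<open>T\<close> makes every monomial homogeneous of degree \<open>d\<close>: replacing \<open>F\<close>
  by \<open>s\<^sup>-\<^sup>1 F(sX)\<close> with \<open>s = T ^ (d - 2)\<close> gives the quadratic monomials degree \<open>d\<close> and the cubic ones
  degree \<open>2d - 1\<close>, and the latter split as \<open>T ^ (d - 1)\<close> times a monomial of degree \<open>d\<close>.

  So let \<open>F = X - M(X, \<dots>, X)\<close> with \<open>M\<close> symmetric and \<open>d\<close>-linear.  By homogeneity, invertibility of the
  derivative everywhere means that \<open>A(x) = M(\<cdot>, x, \<dots>, x)\<close> has no nonzero eigenvalue, hence \<open>A(x)\<close> is
  nilpotent of some index \<open>p\<close>, uniformly in \<open>x\<close>.  The formal inverse of \<open>F\<close> is the sum over all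
  \<open>d\<close>-Catalan trees of the tree with \<open>M\<close> at the internal vertices and \<open>x\<close> at the leaves.  Polarising
  \<open>A(x)\<^sup>p = 0\<close> shows that these values add up to zero over every length-\<open>p\<close> shuffle class; if the
  constant function is in the span of the indicators of the classes, the terms with \<open>k\<close> internal
  vertices therefore cancel for all large \<open>k\<close>, and the formal inverse is a polynomial.
\<close>

subsection \<open>Multiadditive functions and polarisation\<close>

text \<open>Families indexed by \<open>I\<close> are total functions here, so the first clause makes
  \<open>B\<close> blind to values off \<open>I\<close>. The second clause is what expanding sums
  slot by slot requires.\<close>

definition multiadditive :: "'s set \<Rightarrow> (('s \<Rightarrow> 'v::ab_group_add) \<Rightarrow> 'w::ab_group_add) \<Rightarrow> bool" where
  "multiadditive I B \<longleftrightarrow>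
     (\<forall>z z'. (\<forall>s\<in>I. z s = z' s) \<longrightarrow> B z = B z') \<and>
     (\<forall>s\<in>I. \<forall>z u v. B (z(s := u + v)) = B (z(s := u)) + B (z(s := v)))"

lemma multiadditive_cong:
  "multiadditive I B \<Longrightarrow> (\<And>s. s \<in> I \<Longrightarrow> z s = z' s) \<Longrightarrow> B z = B z'"
  by (auto simp: multiadditive_def)

lemma multiadditive_add:
  "multiadditive I B \<Longrightarrow> s \<in> I \<Longrightarrow> B (z(s := u + v)) = B (z(s := u)) + B (z(s := v))"
  by (auto simp: multiadditive_def)

lemma multiadditive_zero:
  assumes "multiadditive I B" "s \<in> I" "z s = 0"
  shows "B z = 0"
proof -
  have "B (z(s := 0 + 0)) = B (z(s := 0)) + B (z(s := 0))"
    by (rule multiadditive_add[OF assms(1,2)])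
  moreover have "z(s := 0) = z" using assms(3) by auto
  ultimately show ?thesis by simp
qed

lemma multiadditive_sum:
  assumes "multiadditive I B" "s \<in> I" "finite U"
  shows "B (z(s := (\<Sum>r\<in>U. y r))) = (\<Sum>r\<in>U. B (z(s := y r)))"
  using assms(3)
proof (induction U rule: finite_induct)
  case empty
  show ?case using multiadditive_zero[OF assms(1,2), of "z(s := 0)"] by (simp add: fun_upd_def)
next
  case (insert r U)
  then show ?case by (simp add: multiadditive_add[OF assms(1,2), unfolded fun_upd_def] fun_upd_def)
qed

text \<open>Induction over the set \<open>J\<close> of slots to be expanded. Keeping an arbitrary
  \<open>z\<close> in the other slots lets the step freeze slot \<open>a\<close> at one summand and
  apply the induction hypothesis to the changed \<open>z\<close>.\<close>

lemma multiadditive_expand_on: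
  assumes B: "multiadditive I B" and "finite J" "J \<subseteq> I" "\<And>s. s \<in> J \<Longrightarrow> finite (U s)"
  shows "B (\<lambda>s. if s \<in> J then (\<Sum>r\<in>U s. y s r) else z s)
       = (\<Sum>g\<in>PiE J U. B (\<lambda>s. if s \<in> J then y s (g s) else z s))"
  using assms(2-)
proof (induction J arbitrary: z rule: finite_induct)
  case empty
  then show ?case by simp
next
  case (insert a J)
  let ?z = "\<lambda>r. z(a := y a r)"
  have a: "a \<in> I" using insert by auto
  have e1: "(\<lambda>s. if s \<in> insert a J then (\<Sum>r\<in>U s. y s r) else z s)
     = (\<lambda>s. if s \<in> J then (\<Sum>r\<in>U s. y s r) else z s)(a := (\<Sum>r\<in>U a. y a r))"
    by auto
  have e2: "(\<lambda>s. if s \<in> J then (\<Sum>r\<in>U s. y s r) else z s)(a := y a r)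
     = (\<lambda>s. if s \<in> J then (\<Sum>r\<in>U s. y s r) else ?z r s)" for r
    using insert.hyps by auto
  have e3: "(\<lambda>s. if s \<in> insert a J then y s ((g(a := r)) s) else z s)
     = (\<lambda>s. if s \<in> J then y s (g s) else ?z r s)" for g r
    using insert.hyps by auto
  have fin: "finite (U a)" using insert by auto
  have "B (\<lambda>s. if s \<in> insert a J then (\<Sum>r\<in>U s. y s r) else z s)
      = (\<Sum>r\<in>U a. B (\<lambda>s. if s \<in> J then (\<Sum>r\<in>U s. y s r) else ?z r s))"
    unfolding e1 by (subst multiadditive_sum[OF B a fin]) (simp only: e2)
  also have "\<dots> = (\<Sum>r\<in>U a. \<Sum>g\<in>PiE J U. B (\<lambda>s. if s \<in> J then y s (g s) else ?z r s))"
    using insert by (intro sum.cong refl insert.IH) auto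
  also have "\<dots> = (\<Sum>(r, g)\<in>U a \<times> PiE J U.
      B (\<lambda>s. if s \<in> insert a J then y s ((g(a := r)) s) else z s))"
    unfolding e3 by (simp add: sum.cartesian_product)
  also have "\<dots> = (\<Sum>g\<in>PiE (insert a J) U. B (\<lambda>s. if s \<in> insert a J then y s (g s) else z s))"
    unfolding PiE_insert_eq
    by (subst sum.reindex[OF inj_combinator[OF insert.hyps(2)]])
       (auto simp: case_prod_unfold comp_def)
  finally show ?case .
qed

lemma multiadditive_expand:
  assumes B: "multiadditive I B" and "finite I" "\<And>s. s \<in> I \<Longrightarrow> finite (U s)"
  shows "B (\<lambda>s. \<Sum>r\<in>U s. y s r) = (\<Sum>g\<in>PiE I U. B (\<lambda>s. y s (g s)))"
proof -
  have "B (\<lambda>s. \<Sum>r\<in>U s. y s r) = B (\<lambda>s. if s \<in> I then (\<Sum>r\<in>U s. y s r) else 0)"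
    by (rule multiadditive_cong[OF B]) auto
  also have "\<dots> = (\<Sum>g\<in>PiE I U. B (\<lambda>s. if s \<in> I then y s (g s) else 0))"
    by (rule multiadditive_expand_on[OF B]) (use assms in auto)
  also have "\<dots> = (\<Sum>g\<in>PiE I U. B (\<lambda>s. y s (g s)))"
    by (intro sum.cong refl multiadditive_cong[OF B]) auto
  finally show ?thesis .
qed

text \<open>Adding or removing an element \<open>a\<close> of \<open>I - J\<close> pairs off the
  supersets of \<open>J\<close>, and the two members of a pair have opposite signs.\<close>

lemma alternating_sum_supersets:
  assumes "finite I" "J \<subset> I"
  shows "(\<Sum>U | J \<subseteq> U \<and> U \<subseteq> I. (-1 :: complex) ^ card U) = 0"
proof -
  obtain a where a: "a \<in> I" "a \<notin> J" using assms by auto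
  let ?X = "{U. J \<subseteq> U \<and> U \<subseteq> I \<and> a \<notin> U}"
  have fX: "finite ?X" by (rule finite_subset[of _ "Pow I"]) (use assms in auto)
  have split: "{U. J \<subseteq> U \<and> U \<subseteq> I} = ?X \<union> insert a ` ?X"
  proof (intro equalityI subsetI)
    fix U assume "U \<in> {U. J \<subseteq> U \<and> U \<subseteq> I}"
    then show "U \<in> ?X \<union> insert a ` ?X"
      using a by (cases "a \<in> U") (auto intro!: image_eqI[of _ _ "U - {a}"])
  qed (use a in auto)
  have inj: "inj_on (insert a) ?X" by (auto simp: inj_on_def)
  have "(\<Sum>U | J \<subseteq> U \<and> U \<subseteq> I. (-1 :: complex) ^ card U)
      = (\<Sum>U\<in>?X. (-1) ^ card U) + (\<Sum>U\<in>?X. (-1) ^ card (insert a U))"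
    unfolding split by (subst sum.union_disjoint) (use fX inj in \<open>auto simp: sum.reindex\<close>)
  also have "(\<Sum>U\<in>?X. (-1 :: complex) ^ card (insert a U)) = (\<Sum>U\<in>?X. - ((-1) ^ card U))"
    by (intro sum.cong refl) (use assms in \<open>auto simp: finite_subset card_insert_if\<close>)
  finally show ?thesis by (simp add: sum_negf)
qed

text \<open>Inclusion-exclusion over the subsets \<open>U\<close> of \<open>I\<close>: the diagonal
  values at the partial sums of \<open>w\<close> are all zero, and after expansion a choice function
  \<open>g\<close> is counted with the alternating sum over all \<open>U\<close> containing its
  image. That sum survives only if \<open>g\<close> is onto \<open>I\<close>, hence a permutation.
  Extensional functions count each permutation once.\<close>

lemma polarization_zero:
  fixes B :: "('s \<Rightarrow> 'v::ab_group_add) \<Rightarrow> complex"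
  assumes B: "multiadditive I B" and I: "finite I" and diag: "\<And>y. B (\<lambda>_. y) = 0"
  shows "(\<Sum>\<sigma> | \<sigma> \<in> I \<rightarrow>\<^sub>E I \<and> bij_betw \<sigma> I I. B (\<lambda>s. w (\<sigma> s))) = 0"
proof -
  have fin: "finite (I \<rightarrow>\<^sub>E I)" using I by (intro finite_PiE) auto
  have "0 = (\<Sum>U\<in>Pow I. (-1) ^ card U * B (\<lambda>_. \<Sum>r\<in>U. w r))"
    by (simp add: diag)
  also have "\<dots> = (\<Sum>U\<in>Pow I. \<Sum>g\<in>I \<rightarrow>\<^sub>E U. (-1) ^ card U * B (\<lambda>s. w (g s)))"
  proof (intro sum.cong refl)
    fix U assume "U \<in> Pow I"
    then have "finite U" using I finite_subset by auto
    then show "(-1) ^ card U * B (\<lambda>_. \<Sum>r\<in>U. w r) = (\<Sum>g\<in>I \<rightarrow>\<^sub>E U. (-1) ^ card U * B (\<lambda>s. w (g s)))"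
      using multiadditive_expand[OF B I, of "\<lambda>_. U" "\<lambda>_. w"] by (simp add: sum_distrib_left)
  qed
  \<comment> \<open>Enlarging the range of \<open>g\<close> from \<open>U\<close> to
    \<open>I\<close> makes the two sums independent, so that they can be swapped.\<close>
  also have "\<dots> = (\<Sum>U\<in>Pow I. \<Sum>g\<in>I \<rightarrow>\<^sub>E I. if g ` I \<subseteq> U then (-1) ^ card U * B (\<lambda>s. w (g s)) else 0)"
  proof (rule sum.cong[OF refl])
    fix U assume U: "U \<in> Pow I"
    have "(I \<rightarrow>\<^sub>E U) = {g \<in> I \<rightarrow>\<^sub>E I. g ` I \<subseteq> U}" using U by (auto simp: PiE_iff extensional_def)
    then show "(\<Sum>g\<in>I \<rightarrow>\<^sub>E U. (-1) ^ card U * B (\<lambda>s. w (g s)))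
      = (\<Sum>g\<in>I \<rightarrow>\<^sub>E I. if g ` I \<subseteq> U then (-1) ^ card U * B (\<lambda>s. w (g s)) else 0)"
      using fin by (simp add: sum.inter_filter[symmetric])
  qed
  also have "\<dots> = (\<Sum>g\<in>I \<rightarrow>\<^sub>E I. \<Sum>U\<in>Pow I. if g ` I \<subseteq> U then (-1) ^ card U * B (\<lambda>s. w (g s)) else 0)"
    by (rule sum.swap)
  also have "\<dots> = (\<Sum>g\<in>I \<rightarrow>\<^sub>E I. if bij_betw g I I then (-1) ^ card I * B (\<lambda>s. w (g s)) else 0)"
  proof (intro sum.cong refl)
    fix g assume g: "g \<in> I \<rightarrow>\<^sub>E I"
    have sub: "g ` I \<subseteq> I" using g by auto
    have eq: "(\<Sum>U\<in>Pow I. if g ` I \<subseteq> U then (-1) ^ card U * B (\<lambda>s. w (g s)) else 0)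
        = (\<Sum>U | g ` I \<subseteq> U \<and> U \<subseteq> I. (-1) ^ card U) * B (\<lambda>s. w (g s))"
    proof -
      have "{U \<in> Pow I. g ` I \<subseteq> U} = {U. g ` I \<subseteq> U \<and> U \<subseteq> I}" by auto
      then show ?thesis
        using I by (simp add: sum.inter_filter[symmetric] sum_distrib_right)
    qed
    show "(\<Sum>U\<in>Pow I. if g ` I \<subseteq> U then (-1) ^ card U * B (\<lambda>s. w (g s)) else 0)
        = (if bij_betw g I I then (-1) ^ card I * B (\<lambda>s. w (g s)) else 0)"
    proof (cases "g ` I = I")
      case True
      then have "bij_betw g I I" using I by (simp add: bij_betw_def eq_card_imp_inj_on)
      moreover have "{U. g ` I \<subseteq> U \<and> U \<subseteq> I} = {I}" using True by auto
      ultimately show ?thesis unfolding eq by simp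
    next
      case False
      then have "\<not> bij_betw g I I" by (auto simp: bij_betw_def)
      moreover have "g ` I \<subset> I" using False sub by auto
      ultimately show ?thesis unfolding eq using alternating_sum_supersets[OF I] by simp
    qed
  qed
  also have "\<dots> = (-1) ^ card I * (\<Sum>\<sigma> | \<sigma> \<in> I \<rightarrow>\<^sub>E I \<and> bij_betw \<sigma> I I. B (\<lambda>s. w (\<sigma> s)))"
    using fin by (simp add: sum.inter_filter[symmetric] sum_distrib_left)
  finally show ?thesis by simp
qed

subsection \<open>Evaluating trees and shuffle classes\<close>

text \<open>The default 0 fills the slots beyond the children. When \<open>M\<close> is
  multiadditive on \<open>{..<d}\<close> and the tree is \<open>d\<close>-Catalan, these are slots
  that \<open>M\<close> ignores.\<close>

function tree_eval :: "((nat \<Rightarrow> 'v) \<Rightarrow> 'v::ab_group_add) \<Rightarrow> 'v \<Rightarrow> ptree \<Rightarrow> 'v" where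
  "tree_eval M x (Nd ts) =
     (if ts = [] then x else M (\<lambda>j. if j < length ts then tree_eval M x (ts ! j) else 0))"
  by pat_completeness auto
termination
  by (relation "Wellfounded.measure (\<lambda>(M, x, t). size t)")
     (auto intro!: le_imp_less_Suc size_list_estimation'[OF nth_mem])

text \<open>Vertices addressed in \<open>P\<close> become free variables \<open>z\<close>;
  \<open>a\<close> is the address of the current vertex. This exposes the value of a shuffled tree
  as a function of the values at the sibling positions, to which polarisation applies.\<close>

function graft_eval :: "((nat \<Rightarrow> 'v) \<Rightarrow> 'v::ab_group_add) \<Rightarrow> 'v \<Rightarrow> nat list set \<Rightarrow>
    (nat list \<Rightarrow> 'v) \<Rightarrow> nat list \<Rightarrow> ptree \<Rightarrow> 'v" where
  "graft_eval M x P z a (Nd ts) =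
     (if a \<in> P then z a else if ts = [] then x
      else M (\<lambda>j. if j < length ts then graft_eval M x P z (a @ [j]) (ts ! j) else 0))"
  by pat_completeness auto
termination
  by (relation "Wellfounded.measure (\<lambda>(M, x, P, z, a, t). size t)")
     (auto intro!: le_imp_less_Suc size_list_estimation'[OF nth_mem])

declare tree_eval.simps [simp del] graft_eval.simps [simp del] graft.simps [simp del]

lemma tree_eval_graft:
  "tree_eval M x (graft (\<lambda>b. if b \<in> P then Some (s b) else None) a t)
   = graft_eval M x P (\<lambda>b. tree_eval M x (s b)) a t"
proof (induction t arbitrary: a)
  case (Nd ts)
  show ?case
  proof (cases "a \<in> P \<or> ts = []")
    case True
    then show ?thesis by (auto simp: graft.simps graft_eval.simps tree_eval.simps)
  next
    case False
    have "tree_eval M x (graft (\<lambda>b. if b \<in> P then Some (s b) else None) (a @ [j]) (ts ! j))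
        = graft_eval M x P (\<lambda>b. tree_eval M x (s b)) (a @ [j]) (ts ! j)" if "j < length ts" for j
      using Nd[OF nth_mem[OF that]] .
    then show ?thesis
      using False by (auto simp: graft.simps graft_eval.simps tree_eval.simps intro!: arg_cong[where f = M])
  qed
qed

lemma graft_eval_cong:
  assumes "\<And>r. a @ r \<in> P \<Longrightarrow> z (a @ r) = z' (a @ r)"
  shows "graft_eval M x P z a t = graft_eval M x P z' a t"
  using assms
proof (induction t arbitrary: a)
  case (Nd ts)
  have "graft_eval M x P z (a @ [j]) (ts ! j) = graft_eval M x P z' (a @ [j]) (ts ! j)"
    if "j < length ts" for j
    by (rule Nd(1)[OF nth_mem[OF that]]) (use Nd(2)[of "j # r" for r] in auto)
  then show ?case
    using Nd(2)[of "[]"] by (auto simp: graft_eval.simps intro!: arg_cong[where f = M])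
qed

text \<open>Only the child on the way to \<open>a @ r\<close> notices a change of \<open>z\<close>
  there, so additivity of \<open>M\<close> in one slot passes the sum up from vertex to vertex. No
  proper prefix of the address lies in \<open>P\<close>, so the evaluation does reach that
  vertex.\<close>

lemma graft_eval_additive:
  assumes M: "multiadditive {..<d} M"
    and "is_catalan d t" "is_addr t r" "a @ r \<in> P" "\<And>k. k < length r \<Longrightarrow> a @ take k r \<notin> P"
  shows "graft_eval M x P (z(a @ r := u + v)) a t
       = graft_eval M x P (z(a @ r := u)) a t + graft_eval M x P (z(a @ r := v)) a t"
  using assms(2-)
proof (induction r arbitrary: a t)
  case Nil
  then show ?case by (cases t) (auto simp: graft_eval.simps)
next
  case (Cons i r)
  obtain ts where t: "t = Nd ts" by (cases t)
  have i: "i < length ts" and "ts \<noteq> []" and len: "length ts = d" and a: "a \<notin> P"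
    using Cons.prems(1,2) Cons.prems(4)[of 0] by (auto simp: t)
  let ?b = "a @ i # r"
  let ?h = "\<lambda>z j. if j < length ts then graft_eval M x P z (a @ [j]) (ts ! j) else 0"
  have upd: "?h (z(?b := q)) = (?h z)(i := graft_eval M x P (z(?b := q)) (a @ [i]) (ts ! i))" for q
  proof
    fix j
    have "graft_eval M x P (z(?b := q)) (a @ [j]) (ts ! j) = graft_eval M x P z (a @ [j]) (ts ! j)"
      if "j \<noteq> i" using that by (intro graft_eval_cong) auto
    then show "?h (z(?b := q)) j = ((?h z)(i := graft_eval M x P (z(?b := q)) (a @ [i]) (ts ! i))) j"
      using i by auto
  qed
  have "graft_eval M x P (z(?b := u + v)) (a @ [i]) (ts ! i)
      = graft_eval M x P (z(?b := u)) (a @ [i]) (ts ! i) + graft_eval M x P (z(?b := v)) (a @ [i]) (ts ! i)"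
    using Cons.IH[of "ts ! i" "a @ [i]"] Cons.prems Cons.prems(4)[of "Suc k" for k] i
    by (auto simp: t fun_upd_def)
  then have "M (?h (z(?b := u + v))) = M (?h (z(?b := u))) + M (?h (z(?b := v)))"
    unfolding upd using multiadditive_add[OF M] i len by simp
  then show ?case using a \<open>ts \<noteq> []\<close> unfolding t graft_eval.simps fun_upd_def by simp
qed

text \<open>A zero at a vertex puts a zero into one slot of \<open>M\<close> at its parent, and so
  on upwards. This carries the vanishing at the start of the path up to the root.\<close>

lemma graft_eval_eq_zero:
  assumes M: "multiadditive {..<d} M"
    and "is_catalan d t" "is_addr t r" "\<And>k. k < length r \<Longrightarrow> a @ take k r \<notin> P"
    and "graft_eval M x P z (a @ r) (subtree_at t r) = 0"
  shows "graft_eval M x P z a t = 0"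
  using assms(2-)
proof (induction r arbitrary: a t)
  case Nil
  then show ?case by simp
next
  case (Cons i r)
  obtain ts where t: "t = Nd ts" by (cases t)
  have i: "i < length ts" and "ts \<noteq> []" and len: "length ts = d" and a: "a \<notin> P"
    using Cons.prems(1,2) Cons.prems(3)[of 0] by (auto simp: t)
  have "graft_eval M x P z (a @ [i]) (ts ! i) = 0"
    using Cons.IH[of "ts ! i" "a @ [i]"] Cons.prems Cons.prems(3)[of "Suc k" for k] i
    by (auto simp: t)
  then show ?case
    using a \<open>ts \<noteq> []\<close> i len
    by (simp add: t graft_eval.simps) (rule multiadditive_zero[OF M, of i], auto)
qed

text \<open>With \<open>y\<close> at every sibling, a path vertex applies \<open>M\<close> with
  \<open>y\<close> in all slots except that of the next path vertex, which is \<open>A y\<close>.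
  One factor accumulates per edge, whatever the value at the end of the path.\<close>

lemma graft_eval_const_path:
  assumes M: "multiadditive {..<d} M"
    and sym: "\<And>y w j. j < d \<Longrightarrow> M ((\<lambda>_. y)(j := w)) = A y w"
    and "is_catalan d t" "is_addr t cs" "\<And>k. k < length cs \<Longrightarrow> a @ take k cs \<notin> P"
    and "\<And>k j. k < length cs \<Longrightarrow> j < d \<Longrightarrow> j \<noteq> cs ! k \<Longrightarrow> a @ take k cs @ [j] \<in> P"
  shows "graft_eval M x P (\<lambda>_. y) a t
       = (A y ^^ length cs) (graft_eval M x P (\<lambda>_. y) (a @ cs) (subtree_at t cs))"
  using assms(3-)
proof (induction cs arbitrary: a t)
  case Nil
  then show ?case by simp
next
  case (Cons i r)
  obtain ts where t: "t = Nd ts" by (cases t)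
  have i: "i < length ts" and "ts \<noteq> []" and len: "length ts = d" and a: "a \<notin> P"
    using Cons.prems(1,2) Cons.prems(3)[of 0] by (auto simp: t)
  have IH: "graft_eval M x P (\<lambda>_. y) (a @ [i]) (ts ! i)
      = (A y ^^ length r) (graft_eval M x P (\<lambda>_. y) (a @ i # r) (subtree_at (ts ! i) r))"
    using Cons.IH[of "ts ! i" "a @ [i]"] Cons.prems(1,2) Cons.prems(3,4)[of "Suc k" for k] i
    by (auto simp: t)
  have sib: "graft_eval M x P (\<lambda>_. y) (a @ [j]) (ts ! j) = y" if "j < d" "j \<noteq> i" for j
    using Cons.prems(4)[of 0 j] that by (cases "ts ! j") (auto simp: graft_eval.simps)
  have "graft_eval M x P (\<lambda>_. y) a t
      = M (\<lambda>j. if j < length ts then graft_eval M x P (\<lambda>_. y) (a @ [j]) (ts ! j) else 0)"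
    using a \<open>ts \<noteq> []\<close> by (simp add: t graft_eval.simps)
  also have "\<dots> = M ((\<lambda>_. y)(i := graft_eval M x P (\<lambda>_. y) (a @ [i]) (ts ! i)))"
    by (rule multiadditive_cong[OF M]) (use len sib in auto)
  also have "\<dots> = A y (graft_eval M x P (\<lambda>_. y) (a @ [i]) (ts ! i))"
    using sym i len by auto
  finally show ?case by (simp add: IH t)
qed

text \<open>A sibling position follows the path up to its last index and departs from it there, so
  it is neither on the path nor an ancestor of \<open>v0\<close>.\<close>

lemma prefix_notin_sibling_positions:
  assumes "k \<le> length v0 + length cs"
  shows "take k (v0 @ cs) \<notin> sibling_positions d v0 cs"
proof
  assume "take k (v0 @ cs) \<in> sibling_positions d v0 cs"
  then obtain i j where ij: "i < length cs" "j \<noteq> cs ! i" "take k (v0 @ cs) = v0 @ take i cs @ [j]"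
    by (auto simp: sibling_positions_def)
  have "length (take k (v0 @ cs)) = length v0 + i + 1" unfolding ij(3) using ij(1) by simp
  then have "k = length v0 + i + 1" using assms by simp
  then have "take k (v0 @ cs) ! (length v0 + i) = cs ! i" by (simp add: nth_append)
  moreover have "take k (v0 @ cs) ! (length v0 + i) = j" using ij by (simp add: nth_append)
  ultimately show False using ij by simp
qed

text \<open>Proper prefixes of a sibling position are on the path or above it, so evaluation and
  grafting reach every sibling position.\<close>

lemma sibling_position_prefix:
  assumes "b \<in> sibling_positions d v0 cs" "k < length b"
  shows "take k b \<notin> sibling_positions d v0 cs"
proof -
  obtain i j where ij: "i < length cs" "b = v0 @ take i cs @ [j]"
    using assms by (auto simp: sibling_positions_def)
  then have "k \<le> length v0 + i" using assms(2) by simp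
  then have "k - length v0 \<le> i" by simp
  then have "take k b = take k (v0 @ cs)" using ij by (simp add: min_absorb1 min_absorb2)
  then show ?thesis using prefix_notin_sibling_positions \<open>k \<le> length v0 + i\<close> ij by simp
qed

lemma sibling_positions_antichain:
  assumes "a \<in> sibling_positions d v0 cs" "a @ r \<in> sibling_positions d v0 cs"
  shows "r = []"
  using sibling_position_prefix[OF assms(2), of "length a"] assms(1) by (cases r) auto

lemma finite_sibling_positions: "finite (sibling_positions d v0 cs)"
proof -
  have "sibling_positions d v0 cs \<subseteq> (\<lambda>(i, j). v0 @ take i cs @ [j]) ` ({..<length cs} \<times> {..<d})"
    by (auto simp: sibling_positions_def)
  then show ?thesis by (rule finite_subset) auto
qed

section \<open>Valid addresses, grafting and the number of internal vertices\<close>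

lemma is_catalan_subtree_at: "is_catalan d t \<Longrightarrow> is_addr t r \<Longrightarrow> is_catalan d (subtree_at t r)"
  by (induction t r rule: subtree_at.induct) auto

lemma is_addr_append: "is_addr t (r @ r') \<longleftrightarrow> is_addr t r \<and> is_addr (subtree_at t r) r'"
  by (induction t r rule: subtree_at.induct) auto

text \<open>A path vertex with a successor is internal, so in a \<open>d\<close>-Catalan tree it has
  all \<open>d\<close> children.\<close>

lemma is_addr_sibling_position:
  assumes T: "is_catalan d T" "is_addr T (v0 @ cs)" and b: "b \<in> sibling_positions d v0 cs"
  shows "is_addr T b"
proof -
  obtain i j where ij: "i < length cs" "j < d" "b = v0 @ take i cs @ [j]"
    using b by (auto simp: sibling_positions_def)
  let ?a = "v0 @ take i cs"
  have "v0 @ cs = ?a @ cs ! i # drop (Suc i) cs" using ij by (simp add: id_take_nth_drop)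
  then have "is_addr T (?a @ cs ! i # drop (Suc i) cs)" using T(2) by metis
  then have a: "is_addr T ?a" "is_addr (subtree_at T ?a) (cs ! i # drop (Suc i) cs)"
    unfolding is_addr_append[of T ?a] by auto
  moreover have "is_catalan d (subtree_at T ?a)" using T a by (intro is_catalan_subtree_at) auto
  ultimately have "is_addr (subtree_at T ?a) [j]" using ij by (cases "subtree_at T ?a") auto
  then show ?thesis using a is_addr_append[of T ?a "[j]"] ij by simp
qed

text \<open>\<open>graft\<close> stops at the first replaced vertex, which is why no proper prefix
  may be replaced. Reading the grafted subtrees back shows that a shuffled tree determines its
  family of sibling subtrees.\<close>

lemma subtree_at_graft:
  assumes "is_addr t r" "f (a @ r) = Some s" "\<And>k. k < length r \<Longrightarrow> f (a @ take k r) = None"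
  shows "subtree_at (graft f a t) r = s"
  using assms
proof (induction r arbitrary: a t)
  case Nil
  then show ?case by (cases t) (auto simp: graft.simps)
next
  case (Cons i r)
  obtain ts where t: "t = Nd ts" by (cases t)
  show ?case
    using Cons.IH[of "ts ! i" "a @ [i]"] Cons.prems(1,2) Cons.prems(3)[of 0] Cons.prems(3)[of "Suc k" for k]
    by (auto simp: t graft.simps)
qed


lemma is_catalan_graft:
  assumes "is_catalan d t" "\<And>b s. f b = Some s \<Longrightarrow> is_catalan d s"
  shows "is_catalan d (graft f a t)"
  using assms(1)
proof (induction t arbitrary: a)
  case (Nd ts)
  show ?case
  proof (cases "f a")
    case None
    have "is_catalan d (graft f (a @ [j]) (ts ! j))" if "j < length ts" for j
      using Nd that by auto
    then show ?thesis using None Nd.prems by (auto simp: graft.simps)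
  next
    case (Some s)
    then show ?thesis using assms(2) by (simp add: graft.simps)
  qed
qed

text \<open>Removed subtrees are added on the left and inserted ones on the right, which avoids
  subtraction of naturals. The antichain condition says that nothing is replaced inside a replaced
  subtree.\<close>

lemma internal_count_graft:
  assumes "finite P" and antichain: "\<And>b r. b \<in> P \<Longrightarrow> b @ r \<in> P \<Longrightarrow> r = []"
  shows "internal_count (graft (\<lambda>b. if b \<in> P then Some (s b) else None) a t)
    + (\<Sum>r | is_addr t r \<and> a @ r \<in> P. internal_count (subtree_at t r))
    = internal_count t + (\<Sum>r | is_addr t r \<and> a @ r \<in> P. internal_count (s (a @ r)))"
proof (induction t arbitrary: a)
  case (Nd ts)
  let ?f = "\<lambda>b. if b \<in> P then Some (s b) else None"
  let ?R = "\<lambda>a t. {r. is_addr t r \<and> a @ r \<in> P}"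
  have finR: "finite (?R a t)" for a t
    by (rule finite_subset[of _ "(\<lambda>b. drop (length a) b) ` P"])
       (use assms(1) in \<open>auto intro!: image_eqI[of _ _ "a @ r" for r]\<close>)
  show ?case
  proof (cases "a \<in> P")
    case True
    then have "?R a (Nd ts) = {[]}" using antichain[OF True] by auto
    then show ?thesis using True by (simp add: graft.simps)
  next
    case False
    \<comment> \<open>The root is outside \<open>P\<close>, so the replaced addresses split
      according to their first index.\<close>
    have R: "?R a (Nd ts) = (\<Union>j\<in>{..<length ts}. (#) j ` ?R (a @ [j]) (ts ! j))"
    proof (intro equalityI subsetI)
      fix r assume "r \<in> ?R a (Nd ts)"
      then show "r \<in> (\<Union>j\<in>{..<length ts}. (#) j ` ?R (a @ [j]) (ts ! j))"
        using False by (cases r) auto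
    qed auto
    have sum_R: "(\<Sum>r\<in>?R a (Nd ts). h r) = (\<Sum>j<length ts. \<Sum>r\<in>?R (a @ [j]) (ts ! j). h (j # r))"
      for h :: "nat list \<Rightarrow> nat"
      unfolding R by (subst sum.UNION_disjoint) (use finR in \<open>auto simp: sum.reindex simp del: append_assoc\<close>)
    have "internal_count (graft ?f (a @ [j]) (ts ! j))
       + (\<Sum>r\<in>?R (a @ [j]) (ts ! j). internal_count (subtree_at (ts ! j) r))
       = internal_count (ts ! j) + (\<Sum>r\<in>?R (a @ [j]) (ts ! j). internal_count (s (a @ j # r)))"
      if "j < length ts" for j
      using Nd[OF nth_mem[OF that], of "a @ [j]"] by simp
    then have "(\<Sum>j<length ts. internal_count (graft ?f (a @ [j]) (ts ! j))
       + (\<Sum>r\<in>?R (a @ [j]) (ts ! j). internal_count (subtree_at (ts ! j) r)))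
       = (\<Sum>j<length ts. internal_count (ts ! j)
           + (\<Sum>r\<in>?R (a @ [j]) (ts ! j). internal_count (s (a @ j # r))))"
      by (intro sum.cong) auto
    then show ?thesis
      unfolding sum_R using False
      by (simp add: graft.simps sum.distrib sum_list_sum_nth atLeast0LessThan)
  qed
qed

text \<open>The inserted subtrees are a permutation of the removed ones, so the two corrections in
  \<open>internal_count_graft\<close> agree.\<close>

lemma shuffle_class_subset:
  assumes T: "T \<in> catalan_trees d k" and addr: "is_addr T (v0 @ cs)"
  shows "shuffle_class d T v0 cs \<subseteq> catalan_trees d k"
proof
  fix T' assume "T' \<in> shuffle_class d T v0 cs"
  let ?P = "sibling_positions d v0 cs"
  obtain \<sigma> where \<sigma>: "bij_betw \<sigma> ?P ?P" and
    T': "T' = graft (\<lambda>b. if b \<in> ?P then Some (subtree_at T (\<sigma> b)) else None) [] T"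
    using \<open>T' \<in> _\<close> by (auto simp: shuffle_class_def)
  have cat: "is_catalan d T" using T by (simp add: catalan_trees_def)
  have addrP: "is_addr T b" if "b \<in> ?P" for b
    using is_addr_sibling_position[OF cat addr that] .
  have "is_catalan d T'"
    unfolding T'
  proof (rule is_catalan_graft[OF cat])
    fix b s assume "(if b \<in> ?P then Some (subtree_at T (\<sigma> b)) else None) = Some s"
    then have "b \<in> ?P" "s = subtree_at T (\<sigma> b)" by (auto split: if_splits)
    then show "is_catalan d s"
      using \<sigma> addrP cat by (auto intro!: is_catalan_subtree_at dest: bij_betwE)
  qed
  moreover have "internal_count T' = internal_count T"
  proof -
    have P: "{r. is_addr T r \<and> [] @ r \<in> ?P} = ?P" using addrP by auto
    have "internal_count T' + (\<Sum>b\<in>?P. internal_count (subtree_at T b))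
        = internal_count T + (\<Sum>b\<in>?P. internal_count (subtree_at T (\<sigma> b)))"
      using internal_count_graft[OF finite_sibling_positions[of d v0 cs] sibling_positions_antichain,
          where s = "\<lambda>b. subtree_at T (\<sigma> b)" and a = "[]" and t = T]
      unfolding P T' by simp
    also have "(\<Sum>b\<in>?P. internal_count (subtree_at T (\<sigma> b))) = (\<Sum>b\<in>?P. internal_count (subtree_at T b))"
      by (rule sum.reindex_bij_betw[OF \<sigma>])
    finally show ?thesis by simp
  qed
  ultimately show "T' \<in> catalan_trees d k" using T by (simp add: catalan_trees_def)
qed

text \<open>Different permutations may give the same tree, but all fibres of this parametrisation have the
  size of the stabiliser of the family of sibling subtrees.\<close>

lemma sum_over_shuffle_class:
  fixes h :: "ptree \<Rightarrow> complex"
  assumes cat: "is_catalan d T" and addr: "is_addr T (v0 @ cs)"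
  defines "P \<equiv> sibling_positions d v0 cs"
  defines "gr \<equiv> \<lambda>\<sigma>. graft (\<lambda>b. if b \<in> P then Some (subtree_at T (\<sigma> b)) else None) [] T"
  assumes zero: "(\<Sum>\<sigma> | \<sigma> \<in> P \<rightarrow>\<^sub>E P \<and> bij_betw \<sigma> P P. h (gr \<sigma>)) = 0"
  shows "(\<Sum>T'\<in>shuffle_class d T v0 cs. h T') = 0"
proof -
  let ?B = "{\<sigma>. \<sigma> \<in> P \<rightarrow>\<^sub>E P \<and> bij_betw \<sigma> P P}"
  let ?w = "subtree_at T"
  let ?Stab = "{\<tau> \<in> ?B. \<forall>b\<in>P. ?w (\<tau> b) = ?w b}"
  have finP: "finite P" unfolding P_def by (rule finite_sibling_positions)
  have finB: "finite ?B"
    by (rule finite_subset[of _ "P \<rightarrow>\<^sub>E P"]) (use finP in \<open>auto intro: finite_PiE\<close>)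
  have gr_eq: "gr \<sigma> = gr \<tau> \<longleftrightarrow> (\<forall>b\<in>P. ?w (\<sigma> b) = ?w (\<tau> b))" for \<sigma> \<tau>
  proof
    assume "\<forall>b\<in>P. ?w (\<sigma> b) = ?w (\<tau> b)"
    then have "(\<lambda>b. if b \<in> P then Some (?w (\<sigma> b)) else None) = (\<lambda>b. if b \<in> P then Some (?w (\<tau> b)) else None)"
      by auto
    then show "gr \<sigma> = gr \<tau>" by (simp add: gr_def)
  next
    assume eq: "gr \<sigma> = gr \<tau>"
    have "subtree_at (gr \<rho>) b = ?w (\<rho> b)" if "b \<in> P" for \<rho> b
      unfolding gr_def using that is_addr_sibling_position[OF cat addr, of b]
        sibling_position_prefix[of b d v0 cs]
      by (intro subtree_at_graft) (auto simp: P_def)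
    then show "\<forall>b\<in>P. ?w (\<sigma> b) = ?w (\<tau> b)" using eq by metis
  qed
  \<comment> \<open>\<open>shuffle_class\<close> ranges over total functions, \<open>?B\<close> over
    extensional ones; restriction to \<open>P\<close> passes between them and leaves the tree
    unchanged.\<close>
  have restrB: "restrict \<sigma> P \<in> ?B" if "bij_betw \<sigma> P P" for \<sigma>
    using that by (simp add: restrict_PiE_iff bij_betw_apply)
  have class_eq: "shuffle_class d T v0 cs = gr ` ?B"
  proof (intro equalityI subsetI)
    fix T' assume "T' \<in> shuffle_class d T v0 cs"
    then obtain \<sigma> where \<sigma>: "bij_betw \<sigma> P P" "T' = gr \<sigma>"
      by (auto simp: shuffle_class_def P_def gr_def)
    have "gr (restrict \<sigma> P) = gr \<sigma>" by (simp add: gr_eq)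
    then show "T' \<in> gr ` ?B" using imageI[OF restrB[OF \<sigma>(1)], of gr] \<sigma>(2) by simp
  qed (auto simp: shuffle_class_def P_def gr_def)
  have fiber: "card {\<sigma> \<in> ?B. gr \<sigma> = T'} = card ?Stab" if T': "T' \<in> gr ` ?B" for T'
  proof -
    obtain \<rho> where \<rho>: "\<rho> \<in> ?B" "T' = gr \<rho>" using T' by auto
    let ?i = "inv_into P \<rho>"
    have bij: "bij_betw \<rho> P P" "bij_betw ?i P P" using \<rho> by (auto intro: bij_betw_inv_into)
    have i: "\<rho> (?i b) = b" "?i (\<rho> b) = b" "\<rho> b \<in> P" "?i b \<in> P" if "b \<in> P" for b
      using that bij by (auto simp: bij_betw_inv_into_left bij_betw_inv_into_right dest: bij_betwE)
    \<comment> \<open>Composition with one member \<open>\<rho>\<close> of the fibre translates the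
      stabiliser onto the whole fibre.\<close>
    have "bij_betw (\<lambda>\<tau>. restrict (\<tau> \<circ> \<rho>) P) ?Stab {\<sigma> \<in> ?B. gr \<sigma> = T'}"
    proof (rule bij_betw_byWitness[where f' = "\<lambda>\<sigma>. restrict (\<sigma> \<circ> ?i) P"])
      show "\<forall>\<tau>\<in>?Stab. restrict (restrict (\<tau> \<circ> \<rho>) P \<circ> ?i) P = \<tau>"
        by (auto simp: fun_eq_iff i PiE_iff extensional_def)
      show "\<forall>\<sigma>\<in>{\<sigma> \<in> ?B. gr \<sigma> = T'}. restrict (restrict (\<sigma> \<circ> ?i) P \<circ> \<rho>) P = \<sigma>"
        by (auto simp: fun_eq_iff i PiE_iff extensional_def)
      show "(\<lambda>\<tau>. restrict (\<tau> \<circ> \<rho>) P) ` ?Stab \<subseteq> {\<sigma> \<in> ?B. gr \<sigma> = T'}"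
      proof (rule image_subsetI)
        fix \<tau> assume \<tau>: "\<tau> \<in> ?Stab"
        then have "restrict (\<tau> \<circ> \<rho>) P \<in> ?B" by (intro restrB bij_betw_trans[OF bij(1)]) simp
        moreover have "gr (restrict (\<tau> \<circ> \<rho>) P) = T'" using \<tau> by (simp add: gr_eq \<rho>(2) i)
        ultimately show "restrict (\<tau> \<circ> \<rho>) P \<in> {\<sigma> \<in> ?B. gr \<sigma> = T'}" by simp
      qed
      show "(\<lambda>\<sigma>. restrict (\<sigma> \<circ> ?i) P) ` {\<sigma> \<in> ?B. gr \<sigma> = T'} \<subseteq> ?Stab"
      proof (rule image_subsetI)
        fix \<sigma> assume \<sigma>: "\<sigma> \<in> {\<sigma> \<in> ?B. gr \<sigma> = T'}"
        then have "restrict (\<sigma> \<circ> ?i) P \<in> ?B" by (intro restrB bij_betw_trans[OF bij(2)]) simp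
        moreover have "\<forall>b\<in>P. ?w (restrict (\<sigma> \<circ> ?i) P b) = ?w b" using \<sigma> by (simp add: gr_eq \<rho>(2) i)
        ultimately show "restrict (\<sigma> \<circ> ?i) P \<in> ?Stab" by simp
      qed
    qed
    then show ?thesis by (simp add: bij_betw_same_card)
  qed
  have "0 = (\<Sum>\<sigma>\<in>?B. h (gr \<sigma>))" using zero by simp
  also have "\<dots> = (\<Sum>T'\<in>gr ` ?B. \<Sum>\<sigma> | \<sigma> \<in> ?B \<and> gr \<sigma> = T'. h (gr \<sigma>))"
    by (rule sum.image_gen[OF finB])
  also have "\<dots> = (\<Sum>T'\<in>gr ` ?B. of_nat (card ?Stab) * h T')"
  proof (rule sum.cong[OF refl])
    fix T' assume "T' \<in> gr ` ?B"
    have "(\<Sum>\<sigma> | \<sigma> \<in> ?B \<and> gr \<sigma> = T'. h (gr \<sigma>)) = (\<Sum>\<sigma> | \<sigma> \<in> ?B \<and> gr \<sigma> = T'. h T')"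
      by (rule sum.cong) auto
    then show "(\<Sum>\<sigma> | \<sigma> \<in> ?B \<and> gr \<sigma> = T'. h (gr \<sigma>)) = of_nat (card ?Stab) * h T'"
      using fiber[OF \<open>T' \<in> gr ` ?B\<close>] by simp
  qed
  also have "\<dots> = of_nat (card ?Stab) * (\<Sum>T'\<in>shuffle_class d T v0 cs. h T')"
    by (simp add: class_eq sum_distrib_left)
  finally have 0: "of_nat (card ?Stab) * (\<Sum>T'\<in>shuffle_class d T v0 cs. h T') = 0" by simp
  \<comment> \<open>The identity lies in the stabiliser, so the cardinality is nonzero and can be
    cancelled.\<close>
  have "restrict id P \<in> ?Stab" by (auto simp: bij_betw_def)
  then have "?Stab \<noteq> {}" by (intro notI) (simp only: empty_iff)
  moreover have "finite ?Stab" by (rule finite_subset[OF _ finB]) auto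
  ultimately have "card ?Stab > 0" unfolding card_gt_0_iff by (rule conjI)
  then show ?thesis using 0 by simp
qed

text \<open>Polarisation applied to \<open>graft_eval\<close> as a function of the sibling values.
  On the diagonal the path contributes \<open>A y\<close> to the power \<open>length cs\<close>,
  which is zero, and this zero is carried from \<open>v0\<close> up to the root.\<close>

lemma shuffle_class_eval_zero:
  fixes M :: "(nat \<Rightarrow> nat \<Rightarrow> complex) \<Rightarrow> nat \<Rightarrow> complex"
  assumes M: "multiadditive {..<d} M"
    and sym: "\<And>y w j. j < d \<Longrightarrow> M ((\<lambda>_. y)(j := w)) = A y w"
    and nil: "\<And>y w. (A y ^^ length cs) w = 0"
    and cat: "is_catalan d T" and addr: "is_addr T (v0 @ cs)"
  shows "(\<Sum>T'\<in>shuffle_class d T v0 cs. tree_eval M x T' i) = 0"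
proof (rule sum_over_shuffle_class[OF cat addr])
  let ?P = "sibling_positions d v0 cs"
  let ?B = "\<lambda>z. graft_eval M x ?P z [] T i"
  have "multiadditive ?P ?B"
    unfolding multiadditive_def
  proof (intro conjI allI impI ballI)
    fix z z' :: "nat list \<Rightarrow> nat \<Rightarrow> complex" assume "\<forall>s\<in>?P. z s = z' s"
    then have "graft_eval M x ?P z [] T = graft_eval M x ?P z' [] T" by (intro graft_eval_cong) auto
    then show "?B z = ?B z'" by simp
  next
    fix b and z :: "nat list \<Rightarrow> nat \<Rightarrow> complex" and u v assume b: "b \<in> ?P"
    show "?B (z(b := u + v)) = ?B (z(b := u)) + ?B (z(b := v))"
      using graft_eval_additive[OF M cat is_addr_sibling_position[OF cat addr b], of "[]" ?P x z u v]
        b sibling_position_prefix[OF b] by simp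
  qed
  moreover have "?B (\<lambda>_. y) = 0" for y
  proof -
    have cat': "is_catalan d (subtree_at T v0)" and addr': "is_addr T v0" "is_addr (subtree_at T v0) cs"
      using addr cat by (auto simp: is_addr_append intro: is_catalan_subtree_at)
    have np: "take k v0 \<notin> ?P" if "k \<le> length v0" for k
      using prefix_notin_sibling_positions[of k v0 cs d] that by simp
    have "graft_eval M x ?P (\<lambda>_. y) v0 (subtree_at T v0) = 0"
      using prefix_notin_sibling_positions[of "length v0 + k" v0 cs d for k]
      by (subst graft_eval_const_path[OF M sym cat' addr'(2)])
         (auto simp: nil, auto simp: sibling_positions_def)
    then have "graft_eval M x ?P (\<lambda>_. y) [] T = 0"
      by (intro graft_eval_eq_zero[OF M cat addr'(1)]) (use np in auto)
    then show ?thesis by simp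
  qed
  ultimately show "(\<Sum>\<sigma> | \<sigma> \<in> ?P \<rightarrow>\<^sub>E ?P \<and> bij_betw \<sigma> ?P ?P.
      tree_eval M x (graft (\<lambda>b. if b \<in> ?P then Some (subtree_at T (\<sigma> b)) else None) [] T) i) = 0"
    unfolding tree_eval_graft
    using polarization_zero[OF _ finite_sibling_positions, of d v0 cs ?B "\<lambda>b. tree_eval M x (subtree_at T b)"]
    by simp
qed

section \<open>Cancellation over all trees with a given number of internal vertices\<close>

lemma finite_catalan_trees: "finite (catalan_trees d k)"
proof (induction k rule: less_induct)
  case (less k)
  let ?L = "{ts. set ts \<subseteq> (\<Union>j<k. catalan_trees d j) \<and> length ts = d}"
  have "catalan_trees d k \<subseteq> insert (Nd []) (Nd ` ?L)"
  proof
    fix T assume T: "T \<in> catalan_trees d k"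
    obtain ts where ts: "T = Nd ts" by (cases T)
    show "T \<in> insert (Nd []) (Nd ` ?L)"
    proof (cases "ts = []")
      case False
      have "t \<in> (\<Union>j<k. catalan_trees d j)" if "t \<in> set ts" for t
      proof -
        have "internal_count t \<le> sum_list (map internal_count ts)"
          using that by (simp add: member_le_sum_list)
        then have "internal_count t < k" using T False by (simp add: ts catalan_trees_def)
        then show ?thesis using T that by (auto simp: ts catalan_trees_def)
      qed
      then show ?thesis using T False by (auto simp: ts catalan_trees_def)
    qed (use ts in simp)
  qed
  moreover have "finite ?L" using less by (intro finite_lists_length_eq) auto
  ultimately show ?case by (meson finite_imageI finite_insert finite_subset)
qed

text \<open>Insert the constant 1 as a combination of indicators and swap the sums. Each class lies
  inside \<open>catalan_trees d k\<close>, so its indicator selects the full class sum, which is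
  zero.\<close>

lemma level_sum_zero:
  fixes M :: "(nat \<Rightarrow> nat \<Rightarrow> complex) \<Rightarrow> nat \<Rightarrow> complex"
  assumes M: "multiadditive {..<d} M"
    and sym: "\<And>y w j. j < d \<Longrightarrow> M ((\<lambda>_. y)(j := w)) = A y w"
    and nil: "\<And>y w. (A y ^^ p) w = 0"
    and span: "one_in_shuffle_span d k p"
  shows "(\<Sum>T\<in>catalan_trees d k. tree_eval M x T i) = 0"
proof -
  obtain lam :: "ptree set \<Rightarrow> real" where
    lam: "\<And>T. T \<in> catalan_trees d k \<Longrightarrow> (\<Sum>S\<in>shuffle_classes d k p. lam S * indicator S T) = 1"
    using span unfolding one_in_shuffle_span_def by blast
  have S_props: "S \<subseteq> catalan_trees d k \<and> (\<Sum>T\<in>S. tree_eval M x T i) = 0"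
    if "S \<in> shuffle_classes d k p" for S
  proof -
    obtain T v0 cs where S: "S = shuffle_class d T v0 cs" "length cs = p" "is_addr T (v0 @ cs)"
      and T: "T \<in> catalan_trees d k"
      using \<open>S \<in> _\<close> by (auto simp: shuffle_classes_def)
    have "is_catalan d T" using T by (simp add: catalan_trees_def)
    then show ?thesis
      unfolding S(1) using shuffle_class_subset[OF T S(3)] shuffle_class_eval_zero[OF M sym _ _ S(3)] nil S(2)
      by simp
  qed
  have sub: "S \<subseteq> catalan_trees d k" and zero: "(\<Sum>T\<in>S. tree_eval M x T i) = 0"
    if "S \<in> shuffle_classes d k p" for S
    using S_props[OF that] by auto
  have "(\<Sum>T\<in>catalan_trees d k. tree_eval M x T i)
     = (\<Sum>T\<in>catalan_trees d k. complex_of_real (\<Sum>S\<in>shuffle_classes d k p. lam S * indicator S T)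
          * tree_eval M x T i)"
    by (intro sum.cong refl) (simp add: lam)
  also have "\<dots> = (\<Sum>T\<in>catalan_trees d k. \<Sum>S\<in>shuffle_classes d k p.
      lam S * (indicator S T * tree_eval M x T i))"
    by (intro sum.cong refl) (simp add: sum_distrib_left sum_distrib_right mult_ac of_real_indicator)
  also have "\<dots> = (\<Sum>S\<in>shuffle_classes d k p. \<Sum>T\<in>catalan_trees d k.
      lam S * (indicator S T * tree_eval M x T i))"
    by (rule sum.swap)
  also have "\<dots> = (\<Sum>S\<in>shuffle_classes d k p. lam S * (\<Sum>T\<in>S. tree_eval M x T i))"
  proof (rule sum.cong[OF refl])
    fix S assume S: "S \<in> shuffle_classes d k p"
    have "(\<Sum>T\<in>catalan_trees d k. indicator S T * tree_eval M x T i) = (\<Sum>T\<in>S. tree_eval M x T i)"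
      using sub[OF S] finite_catalan_trees
      by (intro sum.mono_neutral_cong_right) (auto simp: indicator_def)
    then show "(\<Sum>T\<in>catalan_trees d k. lam S * (indicator S T * tree_eval M x T i))
        = lam S * (\<Sum>T\<in>S. tree_eval M x T i)"
      by (simp add: sum_distrib_left[symmetric])
  qed
  also have "\<dots> = 0" by (simp add: zero)
  finally show ?thesis .
qed

subsection \<open>The tree expansion of the inverse\<close>

text \<open>The part of the formal inverse of \<open>X - M(X, ..., X)\<close> built from trees with
  \<open>k\<close> internal vertices; for \<open>d\<close>-linear \<open>M\<close> it is homogeneous
  of degree \<open>(d - 1) * k + 1\<close> in \<open>x\<close>.\<close>

definition level_sum :: "((nat \<Rightarrow> 'v) \<Rightarrow> 'v::ab_group_add) \<Rightarrow> nat \<Rightarrow> 'v \<Rightarrow> nat \<Rightarrow> 'v" where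
  "level_sum M d x k = (\<Sum>T\<in>catalan_trees d k. tree_eval M x T)"

lemma level_sum_0: "d > 0 \<Longrightarrow> level_sum M d x 0 = x"
proof -
  assume "d > 0"
  have "catalan_trees d 0 = {Nd []}"
  proof (intro equalityI subsetI)
    fix T assume "T \<in> catalan_trees d 0"
    then show "T \<in> {Nd []}" by (cases T) (auto simp: catalan_trees_def split: if_splits)
  qed (simp add: catalan_trees_def)
  then show ?thesis by (simp add: level_sum_def tree_eval.simps)
qed

text \<open>Cutting off the root leaves \<open>d\<close> subtrees; \<open>\<kappa>\<close> records
  their numbers of internal vertices, which add up to \<open>k\<close> because the root accounts for
  one.\<close>

lemma level_sum_Suc:
  assumes M: "multiadditive {..<d} M" and d: "d > 0"
  shows "level_sum M d x (Suc k)
    = (\<Sum>\<kappa> | \<kappa> \<in> {..<d} \<rightarrow>\<^sub>E {..k} \<and> (\<Sum>j<d. \<kappa> j) = k. M (\<lambda>j. level_sum M d x (\<kappa> j)))"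
proof -
  let ?K = "{\<kappa>. \<kappa> \<in> {..<d} \<rightarrow>\<^sub>E {..k} \<and> (\<Sum>j<d. \<kappa> j) = k}"
  let ?G = "\<lambda>\<kappa>. PiE {..<d} (\<lambda>j. catalan_trees d (\<kappa> j))"
  have fK: "finite ?K"
    by (rule finite_subset[of _ "{..<d} \<rightarrow>\<^sub>E {..k}"]) (auto intro: finite_PiE)
  have fG: "finite (?G \<kappa>)" for \<kappa> by (intro finite_PiE) (auto simp: finite_catalan_trees)
  have "(\<Sum>\<kappa>\<in>?K. M (\<lambda>j. level_sum M d x (\<kappa> j)))
      = (\<Sum>\<kappa>\<in>?K. \<Sum>g\<in>?G \<kappa>. M (\<lambda>j. tree_eval M x (g j)))"
    unfolding level_sum_def
    by (intro sum.cong[OF refl] multiadditive_expand[OF M]) (auto simp: finite_catalan_trees)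
  also have "\<dots> = (\<Sum>(\<kappa>, g)\<in>Sigma ?K ?G. M (\<lambda>j. tree_eval M x (g j)))"
    using fK fG by (intro sum.Sigma) auto
  also have "\<dots> = (\<Sum>T\<in>catalan_trees d (Suc k). tree_eval M x T)"
  proof (rule sum.reindex_bij_witness[where
        j = "\<lambda>(\<kappa>, g). Nd (map g [0..<d])" and
        i = "\<lambda>T. (case T of Nd ts \<Rightarrow> (restrict (\<lambda>j. internal_count (ts ! j)) {..<d}, restrict ((!) ts) {..<d}))"])
    fix p assume p: "p \<in> Sigma ?K ?G"
    obtain \<kappa> g where p_eq: "p = (\<kappa>, g)" by (cases p)
    have \<kappa>: "\<kappa> \<in> {..<d} \<rightarrow>\<^sub>E {..k}" "(\<Sum>j<d. \<kappa> j) = k" and g: "g \<in> ?G \<kappa>"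
      using p by (auto simp: p_eq)
    have gj: "is_catalan d (g j)" "internal_count (g j) = \<kappa> j" if "j < d" for j
      using g that by (auto simp: catalan_trees_def PiE_iff)
    show "(case case p of (\<kappa>, g) \<Rightarrow> Nd (map g [0..<d]) of Nd ts \<Rightarrow>
        (restrict (\<lambda>j. internal_count (ts ! j)) {..<d}, restrict ((!) ts) {..<d})) = p"
      using \<kappa>(1) g gj by (auto simp: p_eq fun_eq_iff PiE_iff extensional_def)
    have "(\<Sum>j\<leftarrow>[0..<d]. internal_count (g j)) = (\<Sum>j<d. \<kappa> j)"
      by (simp add: sum_list_sum_nth atLeast0LessThan gj)
    then show "(case p of (\<kappa>, g) \<Rightarrow> Nd (map g [0..<d])) \<in> catalan_trees d (Suc k)"
      using \<kappa> gj d by (auto simp: p_eq catalan_trees_def comp_def)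
    show "tree_eval M x (case p of (\<kappa>, g) \<Rightarrow> Nd (map g [0..<d]))
        = (case p of (\<kappa>, g) \<Rightarrow> M (\<lambda>j. tree_eval M x (g j)))"
      using d by (simp add: p_eq tree_eval.simps) (rule multiadditive_cong[OF M], simp)
  next
    fix T assume T: "T \<in> catalan_trees d (Suc k)"
    obtain ts where ts: "T = Nd ts" by (cases T)
    have len: "length ts = d" and cat: "\<And>t. t \<in> set ts \<Longrightarrow> is_catalan d t"
      and sum: "sum_list (map internal_count ts) = k"
      using T by (auto simp: ts catalan_trees_def split: if_splits)
    have "map ((!) ts) [0..<d] = ts" using len map_nth by blast
    moreover have "map (restrict ((!) ts) {..<d}) [0..<d] = map ((!) ts) [0..<d]" by simp
    ultimately have e: "map (restrict ((!) ts) {..<d}) [0..<d] = ts" by simp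
    then show "(case (case T of Nd ts \<Rightarrow> (restrict (\<lambda>j. internal_count (ts ! j)) {..<d},
        restrict ((!) ts) {..<d})) of (\<kappa>, g) \<Rightarrow> Nd (map g [0..<d])) = T"
      by (simp add: ts)
    have sum': "(\<Sum>j<d. internal_count (ts ! j)) = k"
      using sum len by (simp add: sum_list_sum_nth atLeast0LessThan)
    have "internal_count (ts ! j) \<le> k" if "j < d" for j
      using sum' member_le_sum[of j "{..<d}" "\<lambda>j. internal_count (ts ! j)"] that by simp
    then show "(case T of Nd ts \<Rightarrow> (restrict (\<lambda>j. internal_count (ts ! j)) {..<d},
        restrict ((!) ts) {..<d})) \<in> Sigma ?K ?G"
      using sum' cat len by (auto simp: ts catalan_trees_def)
  qed
  finally show ?thesis by (simp add: level_sum_def)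
qed

text \<open>The equation is the fixed point form of \<open>g - M(g, ..., g) = x\<close>. Expanding
  \<open>M\<close> at \<open>g\<close> and grouping by total size reproduces the recursion for the
  level sums; truncation at \<open>K\<close> loses nothing because all later levels vanish.\<close>

lemma level_sum_fixpoint:
  assumes M: "multiadditive {..<d} M" and d: "d > 0"
    and K: "\<And>k. k \<ge> K \<Longrightarrow> level_sum M d x k = 0"
  defines "g \<equiv> (\<Sum>k<K. level_sum M d x k)"
  shows "x + M (\<lambda>_. g) = g"
proof -
  let ?G = "level_sum M d x"
  let ?E = "{..<d} \<rightarrow>\<^sub>E {..<K}"
  have fE: "finite ?E" by (intro finite_PiE) auto
  have "M (\<lambda>_. g) = (\<Sum>\<kappa>\<in>?E. M (\<lambda>j. ?G (\<kappa> j)))"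
    unfolding g_def by (rule multiadditive_expand[OF M]) auto
  \<comment> \<open>\<open>d * K\<close> is a crude bound for the sum of \<open>d\<close> numbers
    below \<open>K\<close>, so every family in \<open>?E\<close> falls into some group.\<close>
  also have "\<dots> = (\<Sum>s\<in>{..d * K}. \<Sum>\<kappa> | \<kappa> \<in> ?E \<and> (\<Sum>j<d. \<kappa> j) = s. M (\<lambda>j. ?G (\<kappa> j)))"
  proof (rule sum.group[symmetric, OF fE])
    show "(\<lambda>\<kappa>. \<Sum>j<d. \<kappa> j) ` ?E \<subseteq> {..d * K}"
    proof (rule image_subsetI)
      fix \<kappa> assume "\<kappa> \<in> ?E"
      then have "\<kappa> j \<le> K" if "j < d" for j using that by (auto simp: PiE_iff less_imp_le)
      then have "(\<Sum>j<d. \<kappa> j) \<le> d * K" using sum_bounded_above[of "{..<d}" \<kappa> K] by simp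
      then show "(\<Sum>j<d. \<kappa> j) \<in> {..d * K}" by simp
    qed
  qed simp
  also have "\<dots> = (\<Sum>s\<le>d * K. ?G (Suc s))"
  proof (rule sum.cong[OF refl])
    fix s :: nat
    let ?K = "{\<kappa>. \<kappa> \<in> {..<d} \<rightarrow>\<^sub>E {..s} \<and> (\<Sum>j<d. \<kappa> j) = s}"
    show "(\<Sum>\<kappa> | \<kappa> \<in> ?E \<and> (\<Sum>j<d. \<kappa> j) = s. M (\<lambda>j. ?G (\<kappa> j))) = ?G (Suc s)"
      unfolding level_sum_Suc[OF M d]
    proof (rule sum.mono_neutral_left)
      show "finite ?K"
        by (rule finite_subset[of _ "{..<d} \<rightarrow>\<^sub>E {..s}"]) (auto intro: finite_PiE)
      show "{\<kappa>. \<kappa> \<in> ?E \<and> (\<Sum>j<d. \<kappa> j) = s} \<subseteq> ?K"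
      proof
        fix \<kappa> assume \<kappa>: "\<kappa> \<in> {\<kappa>. \<kappa> \<in> ?E \<and> (\<Sum>j<d. \<kappa> j) = s}"
        then have "\<kappa> j \<le> s" if "j < d" for j
          using member_le_sum[of j "{..<d}" \<kappa>] that by auto
        then show "\<kappa> \<in> ?K" using \<kappa> by (auto simp: PiE_iff)
      qed
      \<comment> \<open>A family in \<open>?K\<close> outside \<open>?E\<close> has a part of size
        at least \<open>K\<close>, which puts a vanishing level sum into a slot of
        \<open>M\<close>.\<close>
      show "\<forall>\<kappa>\<in>?K - {\<kappa>. \<kappa> \<in> ?E \<and> (\<Sum>j<d. \<kappa> j) = s}. M (\<lambda>j. ?G (\<kappa> j)) = 0"
      proof
        fix \<kappa> assume "\<kappa> \<in> ?K - {\<kappa>. \<kappa> \<in> ?E \<and> (\<Sum>j<d. \<kappa> j) = s}"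
        then obtain j where "j < d" "\<kappa> j \<ge> K" by (force simp: PiE_iff)
        then show "M (\<lambda>j. ?G (\<kappa> j)) = 0" using K by (intro multiadditive_zero[OF M, of j]) auto
      qed
    qed
  qed
  finally have "x + M (\<lambda>_. g) = ?G 0 + (\<Sum>s\<le>d * K. ?G (Suc s))" by (simp add: level_sum_0[OF d])
  also have "\<dots> = (\<Sum>k\<le>Suc (d * K). ?G k)" by (simp only: sum.atMost_Suc_shift)
  also have "\<dots> = g"
    unfolding g_def
  proof (rule sum.mono_neutral_right)
    have "K \<le> d * K" using d by simp
    then have "k \<le> Suc (d * K)" if "k < K" for k using that by linarith
    then show "{..<K} \<subseteq> {..Suc (d * K)}" by (auto simp only: lessThan_iff atMost_iff)
  qed (use K in auto)
  finally show ?thesis .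
qed

subsection \<open>Polynomial functions and reduction to homogeneous maps\<close>

text \<open>The coordinate functions \<open>co\<close> are a parameter, so that one notion serves
  both sequences and vectors.\<close>

inductive poly_fun :: "('i \<Rightarrow> 'x \<Rightarrow> complex) \<Rightarrow> ('x \<Rightarrow> complex) \<Rightarrow> bool" for co where
  poly_fun_const: "poly_fun co (\<lambda>_. c)"
| poly_fun_coord: "poly_fun co (\<lambda>x. co i x)"
| poly_fun_add: "poly_fun co f \<Longrightarrow> poly_fun co g \<Longrightarrow> poly_fun co (\<lambda>x. f x + g x)"
| poly_fun_mult: "poly_fun co f \<Longrightarrow> poly_fun co g \<Longrightarrow> poly_fun co (\<lambda>x. f x * g x)"

abbreviation poly_fun_nat :: "((nat \<Rightarrow> complex) \<Rightarrow> complex) \<Rightarrow> bool" where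
  "poly_fun_nat \<equiv> poly_fun (\<lambda>i x. x i)"

lemma poly_fun_subst:
  assumes "poly_fun co f" "\<And>i. poly_fun co' (\<lambda>w. co i (s w))"
  shows "poly_fun co' (\<lambda>w. f (s w))"
  using assms(1)
  by induction (auto intro: assms(2) poly_fun_const poly_fun_add poly_fun_mult)

lemma poly_fun_sum:
  "(\<And>a. a \<in> A \<Longrightarrow> poly_fun co (f a)) \<Longrightarrow> poly_fun co (\<lambda>x. \<Sum>a\<in>A. f a x)"
  by (induction A rule: infinite_finite_induct) (auto intro: poly_fun_const poly_fun_add)

lemma poly_fun_prod:
  "(\<And>a. a \<in> A \<Longrightarrow> poly_fun co (f a)) \<Longrightarrow> poly_fun co (\<lambda>x. \<Prod>a\<in>A. f a x)"
  by (induction A rule: infinite_finite_induct) (auto intro: poly_fun_const poly_fun_mult)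

lemma poly_fun_if: "poly_fun co f \<Longrightarrow> poly_fun co g \<Longrightarrow> poly_fun co (\<lambda>x. if b then f x else g x)"
  by (cases b) auto

lemma poly_fun_power: "poly_fun co f \<Longrightarrow> poly_fun co (\<lambda>x. f x ^ n)"
  by (induction n) (auto intro: poly_fun_const poly_fun_mult)

text \<open>A monomial is a list of variable indices with repetitions: its degree is the length and
  a factorisation is a concatenation.\<close>

definition mon :: "nat list \<Rightarrow> (nat \<Rightarrow> complex) \<Rightarrow> complex" where
  "mon m x = prod_list (map x m)"

primrec dmon :: "nat list \<Rightarrow> (nat \<Rightarrow> complex) \<Rightarrow> (nat \<Rightarrow> complex) \<Rightarrow> complex" where
  "dmon [] x v = 0"
| "dmon (a # m) x v = v a * mon m x + x a * dmon m x v"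

lemma mon_simps [simp]: "mon [] x = 1" "mon (a # m) x = x a * mon m x"
  by (simp_all add: mon_def)

lemma mon_append: "mon (p @ q) x = mon p x * mon q x"
  by (simp add: mon_def)

lemma mon_replicate: "mon (replicate n t) x = x t ^ n"
  by (induction n) auto

lemma dmon_append: "dmon (p @ q) x v = dmon p x v * mon q x + mon p x * dmon q x v"
  by (induction p) (auto simp: mon_append algebra_simps)

lemma mon_cong: "(\<And>a. a \<in> set m \<Longrightarrow> x a = x' a) \<Longrightarrow> mon m x = mon m x'"
  by (induction m) auto

lemma dmon_cong:
  "(\<And>a. a \<in> set m \<Longrightarrow> x a = x' a) \<Longrightarrow> (\<And>a. a \<in> set m \<Longrightarrow> v a = v' a) \<Longrightarrow> dmon m x v = dmon m x' v'"
proof (induction m)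
  case (Cons a m)
  then show ?case using mon_cong[of m x x'] by simp
qed simp

lemma dmon_eq_0: "(\<And>a. a \<in> set m \<Longrightarrow> v a = 0) \<Longrightarrow> dmon m x v = 0"
  by (induction m) auto

lemma mon_scale: "mon m (\<lambda>a. s * x a) = s ^ length m * mon m x"
  by (induction m) auto

lemma dmon_scale: "dmon m (\<lambda>a. s * x a) v = s ^ (length m - 1) * dmon m x v"
proof (induction m)
  case (Cons a m)
  then show ?case by (cases m) (auto simp: mon_scale algebra_simps)
qed simp

lemma dmon_linear: "dmon m x (\<lambda>a. u a + r * v a) = dmon m x u + r * dmon m x v"
  by (induction m) (auto simp: algebra_simps)

lemma mon_has_derivative: "((\<lambda>t. mon m (\<lambda>a. x a + t * v a)) has_field_derivative dmon m x v) (at 0)"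
proof (induction m)
  case (Cons a m)
  show ?case by (auto intro!: derivative_eq_intros Cons)
qed simp

text \<open>Sums append the lists of terms and products concatenate monomials pairwise. Like terms
  are not collected, so the list is not unique and may contain terms that cancel.\<close>

lemma poly_fun_nat_monomials:
  assumes "poly_fun_nat f"
  obtains l where "\<And>x. f x = (\<Sum>(c, m)\<leftarrow>l. c * mon m x)"
proof -
  from assms have "\<exists>l. \<forall>x. f x = (\<Sum>(c, m)\<leftarrow>l. c * mon m x)"
  proof induction
    case (poly_fun_const c)
    show ?case by (rule exI[of _ "[(c, [])]"]) simp
  next
    case (poly_fun_coord i)
    show ?case by (rule exI[of _ "[(1, [i])]"]) simp
  next
    case (poly_fun_add f g)
    then obtain l l' where "\<forall>x. f x = (\<Sum>(c, m)\<leftarrow>l. c * mon m x)" "\<forall>x. g x = (\<Sum>(c, m)\<leftarrow>l'. c * mon m x)"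
      by auto
    then show ?case by (intro exI[of _ "l @ l'"]) simp
  next
    case (poly_fun_mult f g)
    then obtain l l' where l: "\<forall>x. f x = (\<Sum>(c, m)\<leftarrow>l. c * mon m x)"
      "\<forall>x. g x = (\<Sum>(c, m)\<leftarrow>l'. c * mon m x)"
      by auto
    let ?mul = "\<lambda>(c, m). map (\<lambda>(c', m'). (c * c', m @ m')) l'"
    have 1: "(\<Sum>(c, m)\<leftarrow>?mul p. c * mon m x) = fst p * mon (snd p) x * (\<Sum>(c, m)\<leftarrow>l'. c * mon m x)" for p x
      by (induction l') (auto simp: mon_append algebra_simps split: prod.splits)
    have 2: "(\<Sum>(c, m)\<leftarrow>concat (map ?mul l). c * mon m x)
        = (\<Sum>(c, m)\<leftarrow>l. c * mon m x) * (\<Sum>(c, m)\<leftarrow>l'. c * mon m x)" for x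
    proof (induction l)
      case (Cons p l)
      then show ?case using 1[where p = p and x = x] by (cases p) (simp add: algebra_simps)
    qed simp
    show ?case by (rule exI[of _ "concat (map ?mul l)"]) (simp only: l 2 simp_thms)
  qed
  then show ?thesis using that by blast
qed

section \<open>Polynomial maps encoded as lists of monomial terms\<close>

type_synonym monomial_term = "nat \<times> complex \<times> nat list"

text \<open>A list of triples \<open>(i, c, m)\<close> encodes the map with \<open>i\<close>-th component \<open>x\<^sub>i + \<Sum> c x\<^sup>m\<close>, the sum
  ranging over the triples with target \<open>i\<close>.\<close>

definition term_sum :: "(nat list \<Rightarrow> complex) \<Rightarrow> monomial_term list \<Rightarrow> nat \<Rightarrow> complex" where
  "term_sum h ts i = (\<Sum>(j, c, m)\<leftarrow>ts. if j = i then c * h m else 0)"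

definition pmap :: "monomial_term list \<Rightarrow> (nat \<Rightarrow> complex) \<Rightarrow> nat \<Rightarrow> complex" where
  "pmap ts x i = x i + term_sum (\<lambda>m. mon m x) ts i"

text \<open>The Jacobian of \<open>pmap ts\<close> at \<open>x\<close> applied to
  \<open>v\<close>.\<close>

definition dmap :: "monomial_term list \<Rightarrow> (nat \<Rightarrow> complex) \<Rightarrow> (nat \<Rightarrow> complex) \<Rightarrow> nat \<Rightarrow> complex" where
  "dmap ts x v i = v i + term_sum (\<lambda>m. dmon m x v) ts i"

definition targets :: "monomial_term list \<Rightarrow> nat set" where
  "targets ts = fst ` set ts"

definition vars :: "monomial_term list \<Rightarrow> nat set" where
  "vars ts = targets ts \<union> (\<Union>(j, c, m)\<in>set ts. set m)"

text \<open>The maps act on all sequences \<open>nat \<Rightarrow> complex\<close> and are the identity in every variable that is not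
  a target, so adding fresh variables does not change the type; injectivity of the derivative replaces
  the determinant condition.\<close>

definition keller_terms :: "monomial_term list \<Rightarrow> bool" where
  "keller_terms ts \<longleftrightarrow> (\<forall>x v. (\<forall>i. dmap ts x v i = 0) \<longrightarrow> (\<forall>i. v i = 0))"

definition has_right_inverse :: "monomial_term list \<Rightarrow> bool" where
  "has_right_inverse ts \<longleftrightarrow> (\<exists>G. (\<forall>i. poly_fun_nat (\<lambda>w. G w i)) \<and> (\<forall>w i. pmap ts (G w) i = w i))"

lemma finite_vars: "finite (vars ts)"
  by (auto simp: vars_def targets_def)

lemma term_sum_simps [simp]:
  "term_sum h [] i = 0"
  "term_sum h ((j, c, m) # ts) i = (if j = i then c * h m else 0) + term_sum h ts i"
  "term_sum h (us @ vs) i = term_sum h us i + term_sum h vs i"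
  by (simp_all add: term_sum_def)

lemma targets_simps [simp]:
  "targets [] = {}" "targets ((j, c, m) # ts) = insert j (targets ts)"
  "targets (us @ vs) = targets us \<union> targets vs"
  by (auto simp: targets_def)

lemma vars_simps [simp]:
  "vars [] = {}" "vars ((j, c, m) # ts) = insert j (set m \<union> vars ts)"
  "vars (us @ vs) = vars us \<union> vars vs"
  by (auto simp: vars_def)

lemma targets_subset_vars: "targets ts \<subseteq> vars ts"
  by (auto simp: vars_def)

lemma vars_member: "(j, c, m) \<in> set ts \<Longrightarrow> a \<in> set m \<Longrightarrow> a \<in> vars ts"
  by (force simp: vars_def)

lemma term_sum_not_target: "i \<notin> targets ts \<Longrightarrow> term_sum h ts i = 0"
  by (induction ts) auto

lemma term_sum_cong:
  "(\<And>j c m. (j, c, m) \<in> set ts \<Longrightarrow> h m = h' m) \<Longrightarrow> term_sum h ts i = term_sum h' ts i"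
  unfolding term_sum_def by (intro arg_cong[where f = sum_list] map_cong) auto

lemma term_sum_mon_cong:
  "(\<And>a. a \<in> vars ts \<Longrightarrow> x a = x' a) \<Longrightarrow> term_sum (\<lambda>m. mon m x) ts i = term_sum (\<lambda>m. mon m x') ts i"
  by (intro term_sum_cong mon_cong) (auto dest: vars_member)

lemma term_sum_dmon_cong:
  "(\<And>a. a \<in> vars ts \<Longrightarrow> v a = v' a) \<Longrightarrow> term_sum (\<lambda>m. dmon m x v) ts i = term_sum (\<lambda>m. dmon m x v') ts i"
  by (intro term_sum_cong dmon_cong) (auto dest: vars_member)

text \<open>With two fresh variables \<open>y\<close>, \<open>z\<close> the new map has components \<open>F\<^sub>i - (y + P) (z + c Q)\<close>,
  \<open>y + P\<close> and \<open>z + c Q\<close>: it is \<open>F \<times> id\<close> composed with elementary automorphisms on both sides, and the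
  product \<open>c P Q\<close> in \<open>F\<^sub>i\<close> cancels.\<close>

lemma split_product_step:
  fixes us vs :: "monomial_term list" and i :: nat and c :: complex and P Q :: "nat list"
  defines "ts \<equiv> us @ (i, c, P @ Q) # vs"
  assumes y: "y \<notin> vars ts" and z: "z \<notin> vars ts" and yz: "y \<noteq> z"
  defines "ts' \<equiv> (i, -1, [y, z]) # (i, -c, y # Q) # (i, -1, z # P) # (y, 1, P) # (z, c, Q) # us @ vs"
  shows "keller_terms ts \<Longrightarrow> keller_terms ts'" "has_right_inverse ts' \<Longrightarrow> has_right_inverse ts"
proof -
  have fresh: "y \<noteq> i" "z \<noteq> i" "y \<notin> set P" "z \<notin> set P" "y \<notin> set Q" "z \<notin> set Q"
    "y \<notin> targets us" "z \<notin> targets us" "y \<notin> targets vs" "z \<notin> targets vs"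
    using y z targets_subset_vars by (auto simp: ts_def)
  note nt = term_sum_not_target[OF fresh(7)] term_sum_not_target[OF fresh(8)]
    term_sum_not_target[OF fresh(9)] term_sum_not_target[OF fresh(10)]
  have py: "pmap ts' x y = x y + mon P x" and pz: "pmap ts' x z = x z + c * mon Q x" for x
    using fresh yz by (auto simp: ts'_def pmap_def nt)
  have pk: "pmap ts' x k = pmap ts x k - (if k = i then pmap ts' x y * pmap ts' x z else 0)"
    if "k \<noteq> y" "k \<noteq> z" for x k
    unfolding py pz using that by (auto simp: ts'_def ts_def pmap_def mon_append algebra_simps)
  have dy: "dmap ts' x v y = v y + dmon P x v" and dz: "dmap ts' x v z = v z + c * dmon Q x v" for x v
    using fresh yz by (auto simp: ts'_def dmap_def nt)
  have dk: "dmap ts' x v k = dmap ts x v k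
      - (if k = i then dmap ts' x v y * pmap ts' x z + pmap ts' x y * dmap ts' x v z else 0)"
    if "k \<noteq> y" "k \<noteq> z" for x v k
    unfolding py pz dy dz using that by (auto simp: ts'_def ts_def dmap_def dmon_append algebra_simps)
  show "keller_terms ts'" if K: "keller_terms ts"
    unfolding keller_terms_def
  proof (intro allI impI)
    fix x v k assume 0: "\<forall>i. dmap ts' x v i = 0"
    \<comment> \<open>The components \<open>y\<close> and \<open>z\<close> of the new derivative
      vanish, hence so does the correction in \<open>dk\<close>. As \<open>ts\<close> does not
      involve \<open>y\<close> and \<open>z\<close>, clearing them in \<open>v\<close> yields a
      kernel vector of the old derivative.\<close>
    let ?v = "v(y := 0, z := 0)"
    have "dmap ts x ?v k = 0" for k
    proof (cases "k = y \<or> k = z")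
      case True
      then show ?thesis
        using y z targets_subset_vars by (auto simp: dmap_def intro!: term_sum_not_target)
    next
      case False
      have "term_sum (\<lambda>m. dmon m x ?v) ts k = term_sum (\<lambda>m. dmon m x v) ts k"
        using y z by (intro term_sum_dmon_cong) auto
      then have "dmap ts x ?v k = dmap ts x v k" using False by (simp add: dmap_def)
      then show ?thesis using dk[of k x v] False 0 by (simp split: if_splits)
    qed
    then have v0: "?v k = 0" for k using K unfolding keller_terms_def by blast
    then have v: "v a = 0" if "a \<noteq> y" "a \<noteq> z" for a using that by (metis fun_upd_other)
    have "dmon P x v = 0" "dmon Q x v = 0"
      using v fresh(3-6) by (metis dmon_eq_0)+
    then have "v y = 0" "v z = 0" using dy[of x v] dz[of x v] 0 by auto
    then show "v k = 0" using v by metis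
  qed
  show "has_right_inverse ts" if R: "has_right_inverse ts'"
  proof -
    obtain G where G: "\<And>i. poly_fun_nat (\<lambda>w. G w i)" "\<And>w i. pmap ts' (G w) i = w i"
      using R unfolding has_right_inverse_def by blast
    \<comment> \<open>Prescribing the outputs \<open>y\<close> and \<open>z\<close> to be 0 kills
      the correction in \<open>pk\<close>, so the other components of \<open>G\<close> solve the old
      equations. The old map is the identity in \<open>y\<close> and \<open>z\<close>, so there
      \<open>w\<close> itself is put back.\<close>
    let ?W = "\<lambda>w. w(y := 0, z := 0)"
    let ?G = "\<lambda>w. (G (?W w))(y := w y, z := w z)"
    have "poly_fun_nat (\<lambda>w. ?G w k)" for k
    proof (cases "k = y \<or> k = z")
      case True
      then show ?thesis using yz by (auto intro: poly_fun_coord)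
    next
      case False
      have "poly_fun_nat (\<lambda>w. ?W w i)" for i
        unfolding fun_upd_def by (intro poly_fun_if poly_fun_const poly_fun_coord)
      then show ?thesis using poly_fun_subst[OF G(1), of "\<lambda>i x. x i" ?W k] False by simp
    qed
    moreover have "pmap ts (?G w) k = w k" for w k
    proof (cases "k = y \<or> k = z")
      case True
      then have "k \<notin> targets ts" using y z targets_subset_vars by auto
      then show ?thesis using True yz by (auto simp: pmap_def term_sum_not_target)
    next
      case False
      have "pmap ts (?G w) k = pmap ts (G (?W w)) k"
        unfolding pmap_def using False y z
        by (intro arg_cong2[of _ _ _ _ "(+)"] term_sum_mon_cong) auto
      also have "\<dots> = w k" using pk[of k "G (?W w)"] False yz by (simp add: G(2) split: if_splits)
      finally show ?thesis .
    qed
    ultimately show ?thesis unfolding has_right_inverse_def by - (rule exI[of _ ?G], blast)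
  qed
qed

text \<open>If the map fixes all variables of \<open>P\<close>, then \<open>P\<close> is already a function of the output, so one
  fresh variable suffices: the new components are \<open>F\<^sub>i - P (z + c Q)\<close> and \<open>z + c Q\<close>.\<close>

lemma split_passive_factor_step:
  fixes us vs :: "monomial_term list" and i :: nat and c :: complex and P Q :: "nat list"
  defines "ts \<equiv> us @ (i, c, P @ Q) # vs"
  assumes z: "z \<notin> vars ts" and P: "set P \<inter> targets ts = {}"
  defines "ts' \<equiv> (i, -1, P @ [z]) # (z, c, Q) # us @ vs"
  shows "keller_terms ts \<Longrightarrow> keller_terms ts'" "has_right_inverse ts' \<Longrightarrow> has_right_inverse ts"
proof -
  have fresh: "z \<noteq> i" "z \<notin> set P" "z \<notin> set Q" "z \<notin> targets us" "z \<notin> targets vs"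
    using z targets_subset_vars by (auto simp: ts_def)
  note nt = term_sum_not_target[OF fresh(4)] term_sum_not_target[OF fresh(5)]
  have pz: "pmap ts' x z = x z + c * mon Q x" for x
    using fresh by (auto simp: ts'_def pmap_def nt)
  have pk: "pmap ts' x k = pmap ts x k - (if k = i then mon P x * pmap ts' x z else 0)"
    if "k \<noteq> z" for x k
    unfolding pz using that by (auto simp: ts'_def ts_def pmap_def mon_append algebra_simps)
  have dz: "dmap ts' x v z = v z + c * dmon Q x v" for x v
    using fresh by (auto simp: ts'_def dmap_def nt)
  have dk: "dmap ts' x v k = dmap ts x v k
      - (if k = i then dmon P x v * pmap ts' x z + mon P x * dmap ts' x v z else 0)"
    if "k \<noteq> z" for x v k
    unfolding pz dz using that by (auto simp: ts'_def ts_def dmap_def dmon_append algebra_simps)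
  show "keller_terms ts'" if K: "keller_terms ts"
    unfolding keller_terms_def
  proof (intro allI impI)
    fix x v k assume 0: "\<forall>i. dmap ts' x v i = 0"
    \<comment> \<open>The map fixes the variables of \<open>P\<close>, so a kernel vector vanishes
      there and the product rule loses its term with the derivative of \<open>P\<close>.\<close>
    have "v a = 0" if "a \<in> set P" for a
    proof -
      have "a \<notin> targets ts'" using that P fresh by (auto simp: ts_def ts'_def)
      then show ?thesis using 0[rule_format, of a] by (simp add: dmap_def term_sum_not_target)
    qed
    then have P0: "dmon P x v = 0" by (rule dmon_eq_0)
    let ?v = "v(z := 0)"
    have "dmap ts x ?v k = 0" for k
    proof (cases "k = z")
      case True
      then show ?thesis
        using z targets_subset_vars by (auto simp: dmap_def intro!: term_sum_not_target)
    next
      case False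
      have "term_sum (\<lambda>m. dmon m x ?v) ts k = term_sum (\<lambda>m. dmon m x v) ts k"
        using z by (intro term_sum_dmon_cong) auto
      then have "dmap ts x ?v k = dmap ts x v k" using False by (simp add: dmap_def)
      then show ?thesis using dk[of k x v] False 0 P0 by (simp split: if_splits)
    qed
    then have v0: "?v k = 0" for k using K unfolding keller_terms_def by blast
    then have v: "v a = 0" if "a \<noteq> z" for a using that by (metis fun_upd_other)
    have "dmon Q x v = 0" using v fresh(3) by (metis dmon_eq_0)
    then have "v z = 0" using dz[of x v] 0 by auto
    then show "v k = 0" using v by metis
  qed
  show "has_right_inverse ts" if R: "has_right_inverse ts'"
  proof -
    obtain G where G: "\<And>i. poly_fun_nat (\<lambda>w. G w i)" "\<And>w i. pmap ts' (G w) i = w i"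
      using R unfolding has_right_inverse_def by blast
    let ?W = "\<lambda>w. w(z := 0)"
    let ?G = "\<lambda>w. (G (?W w))(z := w z)"
    have "poly_fun_nat (\<lambda>w. ?G w k)" for k
    proof (cases "k = z")
      case True
      then show ?thesis by (auto intro: poly_fun_coord)
    next
      case False
      have "poly_fun_nat (\<lambda>w. ?W w i)" for i
        unfolding fun_upd_def by (intro poly_fun_if poly_fun_const poly_fun_coord)
      then show ?thesis using poly_fun_subst[OF G(1), of "\<lambda>i x. x i" ?W k] False by simp
    qed
    moreover have "pmap ts (?G w) k = w k" for w k
    proof (cases "k = z")
      case True
      then have "k \<notin> targets ts" using z targets_subset_vars by auto
      then show ?thesis using True by (auto simp: pmap_def term_sum_not_target)
    next
      case False
      have "pmap ts (?G w) k = pmap ts (G (?W w)) k"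
        unfolding pmap_def using False z
        by (intro arg_cong2[of _ _ _ _ "(+)"] term_sum_mon_cong) auto
      also have "\<dots> = w k" using pk[of k "G (?W w)"] False by (simp add: G(2) split: if_splits)
      finally show ?thesis .
    qed
    ultimately show ?thesis unfolding has_right_inverse_def by - (rule exI[of _ ?G], blast)
  qed
qed


section \<open>Lowering all degrees to at most three\<close>

lemma fresh_variable: "\<exists>y. y \<notin> vars ts \<and> y \<notin> A" if "finite A" for A :: "nat set"
  using ex_new_if_finite[of "vars ts \<union> A"] finite_vars[of ts] that infinite_UNIV_nat by auto

text \<open>A monomial of degree n > 3 is split into a quadratic \<open>P\<close> and a
  \<open>Q\<close> of degree n - 2. The only new terms that can exceed degree three are
  \<open>y # Q\<close> and \<open>Q\<close>, and 2^(n - 1) + 2^(n - 2) < 2^n makes the total weight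
  \<open>?w\<close> drop.\<close>

lemma reduce_to_cubic:
  assumes cubic: "\<And>ts. keller_terms ts \<Longrightarrow> (\<And>i c m. (i, c, m) \<in> set ts \<Longrightarrow> length m \<in> {2, 3})
      \<Longrightarrow> has_right_inverse ts"
    and "keller_terms ts" "\<And>i c m. (i, c, m) \<in> set ts \<Longrightarrow> length m \<ge> 2"
  shows "has_right_inverse ts"
proof -
  let ?w = "\<lambda>(i :: nat, c :: complex, m :: nat list). if length m \<le> 3 then 0 else (2::nat) ^ length m"
  show ?thesis
    using assms(2,3)
  proof (induction "sum_list (map ?w ts)" arbitrary: ts rule: less_induct)
    case less
    show ?case
    proof (cases "\<forall>(i, c, m)\<in>set ts. length m \<le> 3")
      case True
      have "length m \<in> {2, 3}" if "(i, c, m) \<in> set ts" for i c m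
      proof -
        have "length m \<le> 3" using True that by auto
        then show ?thesis using less.prems(2)[OF that] by auto
      qed
      then show ?thesis using cubic less.prems(1) by blast
    next
      case False
      then obtain i c m where m: "(i, c, m) \<in> set ts" "\<not> length m \<le> 3" by auto
      then obtain us vs where ts: "ts = us @ (i, c, m) # vs" by (auto simp: in_set_conv_decomp)
      define P Q where "P = take 2 m" and "Q = drop 2 m"
      have PQ: "m = P @ Q" "length P = 2" "length Q = length m - 2" using m by (auto simp: P_def Q_def)
      obtain y where y: "y \<notin> vars ts" using fresh_variable[of "{}"] by auto
      obtain z where z: "z \<notin> vars ts" "z \<noteq> y" using fresh_variable[of "{y}"] by auto
      define ts' where
        "ts' = (i, -1, [y, z]) # (i, -c, y # Q) # (i, -1, z # P) # (y, 1, P) # (z, c, Q) # us @ vs"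
      have step: "keller_terms ts \<Longrightarrow> keller_terms ts'" "has_right_inverse ts' \<Longrightarrow> has_right_inverse ts"
        using split_product_step[of y us i c P Q vs z] y z unfolding ts PQ(1)[symmetric] ts'_def by auto
      have "has_right_inverse ts'"
      proof (rule less.hyps)
        define l where "l = length m - 4"
        have l: "length m = l + 4" using m(2) by (simp add: l_def)
        have "?w (i, -c, y # Q) + ?w (z, c, Q) < ?w (i, c, m)"
          using PQ(3) by (auto simp: l power_add)
        then show "sum_list (map ?w ts') < sum_list (map ?w ts)"
          using PQ(2) by (simp add: ts ts'_def)
        show "keller_terms ts'" using step less.prems by blast
        fix i' c' m' assume "(i', c', m') \<in> set ts'"
        then show "length m' \<ge> 2" using less.prems(2)[of i' c' m'] m PQ(2,3)
          by (auto simp: ts ts'_def)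
      qed
      then show ?thesis by (rule step)
    qed
  qed
qed

section \<open>Homogenisation by one further variable\<close>

definition homogenize :: "nat \<Rightarrow> nat \<Rightarrow> monomial_term list \<Rightarrow> monomial_term list" where
  "homogenize t e ts = map (\<lambda>(i, c, m). (i, c, replicate (e * (length m - 1)) t @ m)) ts"

lemma targets_homogenize: "targets (homogenize t e ts) = targets ts"
  by (force simp: targets_def homogenize_def)

lemma term_sum_homogenize:
  "term_sum h (homogenize t e ts) i = term_sum (\<lambda>m. h (replicate (e * (length m - 1)) t @ m)) ts i"
  by (induction ts) (auto simp: homogenize_def)

text \<open>With s = t^e a monomial of degree n >= 1 receives the factor s^(n - 1), as in the
  passage from F(X) to s^-1 F(sX). Since \<open>t\<close> is not a target, kernel vectors have
  \<open>v t = 0\<close>, and on them the derivative at \<open>x\<close> is that of the old map at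
  the scaled point. Prescribing the value 1 for \<open>t\<close> recovers the old map.\<close>

lemma homogenize_step:
  assumes t: "t \<notin> vars ts"
  shows "keller_terms ts \<Longrightarrow> keller_terms (homogenize t e ts)"
    and "has_right_inverse (homogenize t e ts) \<Longrightarrow> has_right_inverse ts"
proof -
  have t': "t \<notin> targets ts" using t targets_subset_vars by auto
  show "keller_terms (homogenize t e ts)" if K: "keller_terms ts"
    unfolding keller_terms_def
  proof (intro allI impI)
    fix x v k assume 0: "\<forall>i. dmap (homogenize t e ts) x v i = 0"
    have vt: "v t = 0"
      using 0[rule_format, of t] t' by (simp add: dmap_def term_sum_not_target targets_homogenize)
    have "dmon (replicate (e * (length m - 1)) t @ m) x v = dmon m (\<lambda>a. x t ^ e * x a) v" for m
      using dmon_eq_0[of "replicate (e * (length m - 1)) t" v x] vt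
      by (simp add: dmon_append mon_replicate dmon_scale power_mult)
    then have "dmap ts (\<lambda>a. x t ^ e * x a) v i = dmap (homogenize t e ts) x v i" for i
      by (simp add: dmap_def term_sum_homogenize)
    then show "v k = 0" using K 0 unfolding keller_terms_def by metis
  qed
  show "has_right_inverse ts" if R: "has_right_inverse (homogenize t e ts)"
  proof -
    obtain G where G: "\<And>i. poly_fun_nat (\<lambda>w. G w i)" "\<And>w i. pmap (homogenize t e ts) (G w) i = w i"
      using R unfolding has_right_inverse_def by blast
    let ?W = "\<lambda>w. w(t := 1)"
    let ?G = "\<lambda>w. (G (?W w))(t := w t)"
    have "poly_fun_nat (\<lambda>w. ?G w k)" for k
    proof (cases "k = t")
      case True
      then show ?thesis by (auto intro: poly_fun_coord)
    next
      case False
      have "poly_fun_nat (\<lambda>w. ?W w i)" for i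
        unfolding fun_upd_def by (intro poly_fun_if poly_fun_const poly_fun_coord)
      then show ?thesis using poly_fun_subst[OF G(1), of "\<lambda>i x. x i" ?W k] False by simp
    qed
    moreover have "pmap ts (?G w) k = w k" for w k
    proof (cases "k = t")
      case True
      then show ?thesis using t' by (auto simp: pmap_def term_sum_not_target)
    next
      case False
      have Gt: "G (?W w) t = 1"
        using G(2)[of "?W w" t] t' by (simp add: pmap_def term_sum_not_target targets_homogenize)
      have "pmap ts (?G w) k = pmap ts (G (?W w)) k"
        unfolding pmap_def using False t
        by (intro arg_cong2[of _ _ _ _ "(+)"] term_sum_mon_cong) auto
      also have "\<dots> = pmap (homogenize t e ts) (G (?W w)) k"
        by (simp add: pmap_def term_sum_homogenize mon_append mon_replicate Gt)
      also have "\<dots> = w k" using False by (simp add: G(2))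
      finally show ?thesis .
    qed
    ultimately show ?thesis unfolding has_right_inverse_def by - (rule exI[of _ ?G], blast)
  qed
qed

text \<open>Each step trades a monomial t^(d - 1) Q of the wrong degree for t^(d - 1) z and Q, both
  of degree \<open>d\<close>. The only new target is \<open>z\<close>, so \<open>t\<close> stays
  fixed by the map and serves again in the next step.\<close>

lemma split_passive_factors:
  assumes hom: "\<And>ts. keller_terms ts \<Longrightarrow> (\<And>i c m. (i, c, m) \<in> set ts \<Longrightarrow> length m = d)
      \<Longrightarrow> has_right_inverse ts"
    and d: "d > 0"
    and "keller_terms ts" "t \<notin> targets ts"
    and "\<And>i c m. (i, c, m) \<in> set ts \<Longrightarrow>
        length m = d \<or> (\<exists>Q. length Q = d \<and> m = replicate (d - 1) t @ Q)"
  shows "has_right_inverse ts"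
  using assms(3-)
proof (induction "length (filter (\<lambda>(i, c, m). length m \<noteq> d) ts)" arbitrary: ts rule: less_induct)
  case less
  show ?case
  proof (cases "\<forall>(i, c, m)\<in>set ts. length m = d")
    case True
    then show ?thesis using hom less.prems(1) by blast
  next
    case False
    then obtain i c m where m: "(i, c, m) \<in> set ts" "length m \<noteq> d" by auto
    then obtain Q where Q: "length Q = d" "m = replicate (d - 1) t @ Q" using less.prems(3) by blast
    obtain us vs where ts: "ts = us @ (i, c, replicate (d - 1) t @ Q) # vs"
      using m Q by (auto simp: in_set_conv_decomp)
    obtain z where z: "z \<notin> vars ts" "z \<noteq> t" using fresh_variable[of "{t}"] by auto
    define ts' where "ts' = (i, -1, replicate (d - 1) t @ [z]) # (z, c, Q) # us @ vs"
    have "set (replicate (d - 1) t) \<inter> targets ts = {}" using less.prems(2) by auto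
    then have step: "keller_terms ts \<Longrightarrow> keller_terms ts'" "has_right_inverse ts' \<Longrightarrow> has_right_inverse ts"
      using split_passive_factor_step[of z us i c "replicate (d - 1) t" Q vs] z
      unfolding ts ts'_def by auto
    have "has_right_inverse ts'"
    proof (rule less.hyps)
      show "length (filter (\<lambda>(i, c, m). length m \<noteq> d) ts') < length (filter (\<lambda>(i, c, m). length m \<noteq> d) ts)"
        using d Q m by (simp add: ts ts'_def)
      show "keller_terms ts'" using step less.prems by blast
      show "t \<notin> targets ts'" using less.prems(2) z by (auto simp: ts ts'_def)
      fix i' c' m' assume "(i', c', m') \<in> set ts'"
      then show "length m' = d \<or> (\<exists>Q. length Q = d \<and> m' = replicate (d - 1) t @ Q)"
        using less.prems(3)[of i' c' m'] d Q by (auto simp: ts ts'_def)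
    qed
    then show ?thesis by (rule step)
  qed
qed

lemma reduce_to_homogeneous:
  assumes hom: "\<And>ts. keller_terms ts \<Longrightarrow> (\<And>i c m. (i, c, m) \<in> set ts \<Longrightarrow> length m = d)
      \<Longrightarrow> has_right_inverse ts"
    and d: "d \<ge> 3"
    and ts: "keller_terms ts" "\<And>i c m. (i, c, m) \<in> set ts \<Longrightarrow> length m \<ge> 2"
  shows "has_right_inverse ts"
proof (rule reduce_to_cubic[OF _ ts])
  fix ts :: "monomial_term list"
  assume K: "keller_terms ts" and len: "\<And>i c m. (i, c, m) \<in> set ts \<Longrightarrow> length m \<in> {2, 3}"
  obtain t where t: "t \<notin> vars ts" using fresh_variable[of "{}"] by auto
  have "has_right_inverse (homogenize t (d - 2) ts)"
  proof (rule split_passive_factors[OF hom])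
    show "keller_terms (homogenize t (d - 2) ts)" using homogenize_step(1)[OF t K] .
    show "t \<notin> targets (homogenize t (d - 2) ts)"
      using t targets_subset_vars by (auto simp: targets_homogenize)
    fix i c m assume "(i, c, m) \<in> set (homogenize t (d - 2) ts)"
    then obtain m' where m': "(i, c, m') \<in> set ts" "m = replicate ((d - 2) * (length m' - 1)) t @ m'"
      by (auto simp: homogenize_def)
    then consider "length m' = 2" | "length m' = 3" using len by blast
    then show "length m = d \<or> (\<exists>Q. length Q = d \<and> m = replicate (d - 1) t @ Q)"
    proof cases
      case 1
      then have "length m = (d - 2) + 2" using m' by simp
      then have "length m = d" using d by linarith
      then show ?thesis by blast
    next
      case 2
      \<comment> \<open>Of the \<open>2 * (d - 2)\<close> copies of \<open>t\<close>,
        \<open>d - 1\<close> form the passive factor and the other \<open>d - 3\<close> bring the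
        cubic monomial up to degree \<open>d\<close>.\<close>
      have "(d - 2) * 2 = (d - 1) + (d - 3)" using d by simp
      then have "m = replicate (d - 1) t @ (replicate (d - 3) t @ m')"
        using 2 m' by (simp add: replicate_add)
      moreover have "length (replicate (d - 3) t @ m') = d" using 2 d by simp
      ultimately show ?thesis by blast
    qed
  qed (use d in auto)
  then show "has_right_inverse ts" using homogenize_step(2)[OF t] by blast
qed auto

subsection \<open>Homogeneous Keller maps\<close>

lemma sum_fun_apply: "(\<Sum>a\<in>A. f a) i = (\<Sum>a\<in>A. f a i)"
  by (induction A rule: infinite_finite_induct) auto

text \<open>Gaussian elimination, one equation at a time: if some unknown \<open>k0\<close> occurs
  in equation \<open>s\<close>, it is solved for and removed, which lowers both cardinalities by
  one.\<close>

lemma homogeneous_system_nontrivial_solution: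
  fixes u :: "'k \<Rightarrow> 'i \<Rightarrow> complex"
  assumes "finite S" "finite K" "card S < card K"
  shows "\<exists>c. (\<exists>k\<in>K. c k \<noteq> 0) \<and> (\<forall>i\<in>S. (\<Sum>k\<in>K. c k * u k i) = 0)"
  using assms
proof (induction S arbitrary: K u rule: finite_induct)
  case empty
  then obtain k where "k \<in> K" by fastforce
  then show ?case by (intro exI[of _ "\<lambda>_. 1"]) auto
next
  case (insert s S)
  show ?case
  proof (cases "\<forall>k\<in>K. u k s = 0")
    case True
    have "card S < card K" using insert by simp
    then obtain c where "\<exists>k\<in>K. c k \<noteq> 0" "\<forall>i\<in>S. (\<Sum>k\<in>K. c k * u k i) = 0"
      using insert.IH[of K u] insert.prems by auto
    then show ?thesis using True by (intro exI[of _ c]) auto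
  next
    case False
    then obtain k0 where k0: "k0 \<in> K" "u k0 s \<noteq> 0" by auto
    let ?K = "K - {k0}"
    \<comment> \<open>The multiple of \<open>u k0\<close> is chosen so that coordinate
      \<open>s\<close> of every \<open>?u k\<close> vanishes.\<close>
    let ?u = "\<lambda>k i. u k i - u k s / u k0 s * u k0 i"
    have "card S < card ?K" using insert k0 by simp
    then obtain c where c: "\<exists>k\<in>?K. c k \<noteq> 0" "\<And>i. i \<in> S \<Longrightarrow> (\<Sum>k\<in>?K. c k * ?u k i) = 0"
      using insert.IH[of ?K ?u] insert.prems by auto
    let ?c = "c(k0 := - (\<Sum>k\<in>?K. c k * u k s / u k0 s))"
    have eq: "(\<Sum>k\<in>K. ?c k * u k i) = (\<Sum>k\<in>?K. c k * ?u k i)" for i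
    proof -
      have "(\<Sum>k\<in>K. ?c k * u k i) = ?c k0 * u k0 i + (\<Sum>k\<in>?K. c k * u k i)"
        using k0 insert.prems by (subst sum.remove[of K k0]) (auto intro!: sum.cong)
      then show ?thesis
        by (simp add: algebra_simps sum_subtractf sum_distrib_left sum_distrib_right)
    qed
    have "(\<Sum>k\<in>?K. c k * ?u k s) = 0" using k0 by simp
    then have "\<forall>i\<in>insert s S. (\<Sum>k\<in>K. ?c k * u k i) = 0" using c(2) eq by auto
    moreover have "\<exists>k\<in>K. ?c k \<noteq> 0" using c(1) by auto
    ultimately show ?thesis by blast
  qed
qed

section \<open>Nilpotency from the absence of nonzero eigenvalues\<close>

lemma funpow_affine:
  fixes A :: "(nat \<Rightarrow> complex) \<Rightarrow> nat \<Rightarrow> complex"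
  assumes "\<And>u v r. A (\<lambda>i. u i + r * v i) = (\<lambda>i. A u i + r * A v i)"
  shows "(A ^^ k) (\<lambda>i. u i + r * v i) = (\<lambda>i. (A ^^ k) u i + r * (A ^^ k) v i)"
  by (induction k) (auto simp: assms)

lemma funpow_zero:
  fixes A :: "(nat \<Rightarrow> complex) \<Rightarrow> nat \<Rightarrow> complex"
  assumes "\<And>u v r. A (\<lambda>i. u i + r * v i) = (\<lambda>i. A u i + r * A v i)"
  shows "(A ^^ k) 0 = 0"
proof -
  \<comment> \<open>Taking \<open>r = -1\<close> and zero vectors turns the linearity equation into
    \<open>A 0 = 0\<close>.\<close>
  have "A (\<lambda>i. 0 + (-1) * 0) = (\<lambda>i. A (\<lambda>_. 0) i + (-1) * A (\<lambda>_. 0) i)"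
    using assms[of "\<lambda>_. 0" "-1" "\<lambda>_. 0"] .
  then have "A 0 = 0" by (simp add: zero_fun_def)
  then show ?thesis by (induction k) auto
qed

text \<open>Induction on the degree of a polynomial \<open>q\<close> with q(A) v = 0. Split off a
  root \<open>l\<close>, so that q = (X - l) r and r(A) annihilates (A - l) v. The induction
  hypothesis makes A^n v an eigenvector for \<open>l\<close> or zero, where n is the degree of r;
  for nonzero \<open>l\<close> it must be zero, and for \<open>l = 0\<close> one more application of
  \<open>A\<close> kills it.\<close>

lemma funpow_degree_eq_0:
  fixes A :: "(nat \<Rightarrow> complex) \<Rightarrow> nat \<Rightarrow> complex"
  assumes lin: "\<And>u v r. A (\<lambda>i. u i + r * v i) = (\<lambda>i. A u i + r * A v i)"
    and eig: "\<And>v l. l \<noteq> 0 \<Longrightarrow> A v = (\<lambda>i. l * v i) \<Longrightarrow> v = 0"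
    and "q \<noteq> 0" "\<And>i. (\<Sum>k\<le>degree q. coeff q k * (A ^^ k) v i) = 0"
  shows "(A ^^ degree q) v = 0"
  using assms(3,4)
proof (induction "degree q" arbitrary: q v)
  case 0
  then have "coeff q 0 \<noteq> 0" by (metis leading_coeff_0_iff)
  then show ?case using 0 by (auto simp: fun_eq_iff)
next
  case (Suc n)
  then have "\<not> constant (poly q)" by (simp add: constant_degree)
  then obtain l where "poly q l = 0" using fundamental_theorem_of_algebra by blast
  then obtain r where q: "q = [:-l, 1:] * r" by (auto simp: poly_eq_0_iff_dvd elim: dvdE)
  have r: "r \<noteq> 0" using Suc.prems q by auto
  then have n: "degree r = n" using Suc.hyps(2) unfolding q by (subst (asm) degree_mult_eq) auto
  have cq: "coeff q k = - l * coeff r k + (case k of 0 \<Rightarrow> 0 | Suc j \<Rightarrow> coeff r j)" for k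
    by (simp add: q coeff_pCons split: nat.split)
  let ?u = "\<lambda>i. A v i + (- l) * v i"
  have u: "(A ^^ k) ?u i = (A ^^ Suc k) v i - l * (A ^^ k) v i" for k i
    using funpow_affine[where A = A, OF lin, of k "A v" "- l" v] by (simp add: funpow_swap1)
  have "(\<Sum>k\<le>degree r. coeff r k * (A ^^ k) ?u i) = 0" for i
  proof -
    have "(\<Sum>k\<le>degree q. coeff q k * (A ^^ k) v i)
        = (\<Sum>k\<le>Suc n. - l * coeff r k * (A ^^ k) v i)
        + (\<Sum>k\<le>Suc n. (case k of 0 \<Rightarrow> 0 | Suc j \<Rightarrow> coeff r j) * (A ^^ k) v i)"
      unfolding Suc.hyps(2)[symmetric] cq by (simp only: ring_distribs sum.distrib)
    also have "(\<Sum>k\<le>Suc n. - l * coeff r k * (A ^^ k) v i) = (\<Sum>k\<le>n. - l * coeff r k * (A ^^ k) v i)"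
      using n by (simp add: coeff_eq_0)
    also have "(\<Sum>k\<le>Suc n. (case k of 0 \<Rightarrow> 0 | Suc j \<Rightarrow> coeff r j) * (A ^^ k) v i)
        = (\<Sum>k\<le>n. coeff r k * (A ^^ Suc k) v i)"
      by (subst sum.atMost_Suc_shift) simp
    also have "(\<Sum>k\<le>n. - l * coeff r k * (A ^^ k) v i) + (\<Sum>k\<le>n. coeff r k * (A ^^ Suc k) v i)
        = (\<Sum>k\<le>degree r. coeff r k * (A ^^ k) ?u i)"
      unfolding n u sum.distrib[symmetric] by (intro sum.cong) (auto simp: algebra_simps)
    finally show ?thesis using Suc.prems(2) by simp
  qed
  then have "(A ^^ degree r) ?u = 0" using Suc.hyps(1)[of r ?u] r n by simp
  then have "(A ^^ n) ?u i = 0" for i using n by simp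
  then have rel: "A ((A ^^ n) v) = (\<lambda>i. l * (A ^^ n) v i)" unfolding u by (auto simp: fun_eq_iff)
  have "A ((A ^^ n) v) = 0"
  proof (cases "l = 0")
    case True
    then show ?thesis using rel by (auto simp: fun_eq_iff)
  next
    case False
    then have "(A ^^ n) v = 0" using eig rel by blast
    then show ?thesis using rel by (auto simp: fun_eq_iff)
  qed
  then show ?case using Suc.hyps(2) by (metis comp_apply funpow.simps(2))
qed

text \<open>One application of \<open>A\<close> moves \<open>w\<close> into the sequences supported
  on \<open>S\<close>, a space of dimension N = \<open>card S\<close>. There N + 1 iterates are
  linearly dependent, which gives a nonzero annihilating polynomial of degree at most N; hence N
  further applications suffice.\<close>

lemma nilpotent_of_no_eigenvalue:
  fixes A :: "(nat \<Rightarrow> complex) \<Rightarrow> nat \<Rightarrow> complex"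
  assumes lin: "\<And>u v r. A (\<lambda>i. u i + r * v i) = (\<lambda>i. A u i + r * A v i)"
    and eig: "\<And>v l. l \<noteq> 0 \<Longrightarrow> A v = (\<lambda>i. l * v i) \<Longrightarrow> v = 0"
    and S: "finite S" "\<And>v i. i \<notin> S \<Longrightarrow> A v i = 0"
  shows "(A ^^ Suc (card S)) w = 0"
proof -
  define v N where "v = A w" and "N = card S"
  have supp: "(A ^^ k) v i = 0" if "i \<notin> S" for k i
    using that S(2) by (cases k) (auto simp: v_def)
  obtain c where c: "\<exists>k\<le>N. c k \<noteq> 0" "\<And>i. i \<in> S \<Longrightarrow> (\<Sum>k\<le>N. c k * (A ^^ k) v i) = 0"
    using homogeneous_system_nontrivial_solution[OF S(1), of "{..N}" "\<lambda>k. (A ^^ k) v"]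
    by (auto simp: N_def)
  define q where "q = (\<Sum>k\<le>N. monom (c k) k)"
  have cq: "coeff q k = (if k \<le> N then c k else 0)" for k
    by (simp add: q_def coeff_sum)
  have q: "q \<noteq> 0" using c(1) cq by (metis coeff_0)
  have deg: "degree q \<le> N" using cq by (auto intro: degree_le)
  have "(\<Sum>k\<le>degree q. coeff q k * (A ^^ k) v i) = 0" for i
  proof -
    have "(\<Sum>k\<le>degree q. coeff q k * (A ^^ k) v i) = (\<Sum>k\<le>N. coeff q k * (A ^^ k) v i)"
      using deg by (intro sum.mono_neutral_left) (auto simp: coeff_eq_0)
    also have "\<dots> = (\<Sum>k\<le>N. c k * (A ^^ k) v i)" by (simp add: cq)
    also have "\<dots> = 0" using c(2) supp by (cases "i \<in> S") auto
    finally show ?thesis .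
  qed
  then have "(A ^^ degree q) v = 0"
    using funpow_degree_eq_0[where A = A and q = q and v = v] lin eig q by blast
  moreover have "A ^^ N = A ^^ (N - degree q) \<circ> A ^^ degree q"
    using deg by (simp add: funpow_add[symmetric])
  ultimately have "(A ^^ N) v = 0" by (simp add: funpow_zero[where A = A, OF lin])
  then show ?thesis by (simp add: v_def N_def funpow_swap1)
qed

text \<open>For \<open>m\<close> of length \<open>d\<close>, the symmetric \<open>d\<close>-linear
  form with diagonal \<open>mon m\<close>: the \<open>d\<close> arguments are distributed over the
  \<open>d\<close> factors in all ways and averaged.\<close>

definition symmetrized_mon :: "nat \<Rightarrow> nat list \<Rightarrow> (nat \<Rightarrow> nat \<Rightarrow> complex) \<Rightarrow> complex" where
  "symmetrized_mon d m y = (\<Sum>\<pi> | \<pi> permutes {..<d}. \<Prod>k<d. y (\<pi> k) (m ! k)) / fact d"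

lemma mon_conv_prod: "mon m x = (\<Prod>k<length m. x (m ! k))"
  by (simp add: mon_def prod.list_conv_set_nth atLeast0LessThan)

lemma dmon_conv_sum:
  "dmon m x v = (\<Sum>k<length m. v (m ! k) * (\<Prod>l\<in>{..<length m} - {k}. x (m ! l)))"
proof (induction m)
  case (Cons a m)
  let ?n = "length m"
  have 0: "(\<Prod>l\<in>{..<Suc ?n} - {0}. x ((a # m) ! l)) = mon m x"
  proof -
    have "{..<Suc ?n} - {0} = Suc ` {..<?n}" by (auto simp: image_iff less_Suc_eq_0_disj)
    then show ?thesis by (simp add: prod.reindex mon_conv_prod)
  qed
  have S: "(\<Prod>l\<in>{..<Suc ?n} - {Suc k}. x ((a # m) ! l)) = x a * (\<Prod>l\<in>{..<?n} - {k}. x (m ! l))" for k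
  proof -
    have "{..<Suc ?n} - {Suc k} = insert 0 (Suc ` ({..<?n} - {k}))"
      by (auto simp: image_iff less_Suc_eq_0_disj)
    then show ?thesis by (simp add: prod.reindex)
  qed
  show ?case
    unfolding length_Cons sum.lessThan_Suc_shift 0 S dmon.simps Cons
    by (simp add: sum_distrib_left mult_ac)
qed simp

lemma symmetrized_mon_diag: "length m = d \<Longrightarrow> symmetrized_mon d m (\<lambda>_. x) = mon m x"
  by (simp add: symmetrized_mon_def mon_conv_prod card_permutations[of "{..<d}" d])

lemma symmetrized_mon_cong:
  assumes "\<And>j. j < d \<Longrightarrow> y j = y' j"
  shows "symmetrized_mon d m y = symmetrized_mon d m y'"
proof -
  have "y (\<pi> k) = y' (\<pi> k)" if "\<pi> permutes {..<d}" "k < d" for \<pi> k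
    using assms permutes_in_image[OF that(1), of k] that(2) by auto
  then show ?thesis
    unfolding symmetrized_mon_def
    by (intro arg_cong2[of _ _ _ _ "(/)"] sum.cong prod.cong refl) auto
qed

text \<open>Under \<open>\<pi>\<close> the slot \<open>j\<close> feeds exactly one factor, the one
  with index \<open>inv \<pi> j\<close>. This makes the additivity in each slot visible.\<close>

lemma symmetrized_mon_upd:
  assumes "j < d"
  shows "symmetrized_mon d m (y(j := u)) = (\<Sum>\<pi> | \<pi> permutes {..<d}.
     u (m ! inv \<pi> j) * (\<Prod>k\<in>{..<d} - {inv \<pi> j}. y (\<pi> k) (m ! k))) / fact d"
  unfolding symmetrized_mon_def
proof (intro arg_cong2[of _ _ _ _ "(/)"] sum.cong refl)
  fix \<pi> assume "\<pi> \<in> {\<pi>. \<pi> permutes {..<d}}"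
  then have \<pi>: "\<pi> permutes {..<d}" by simp
  have k: "inv \<pi> j \<in> {..<d}" "\<pi> (inv \<pi> j) = j"
    using assms \<pi> by (auto simp: permutes_inverses permutes_inv permutes_in_image[OF permutes_inv[OF \<pi>], of j, simplified])
  have "(\<Prod>k<d. (y(j := u)) (\<pi> k) (m ! k))
      = u (m ! inv \<pi> j) * (\<Prod>k\<in>{..<d} - {inv \<pi> j}. (y(j := u)) (\<pi> k) (m ! k))"
    using k by (subst prod.remove[of _ "inv \<pi> j"]) auto
  also have "(\<Prod>k\<in>{..<d} - {inv \<pi> j}. (y(j := u)) (\<pi> k) (m ! k))
      = (\<Prod>k\<in>{..<d} - {inv \<pi> j}. y (\<pi> k) (m ! k))"
    using permutes_inverses(2)[OF \<pi>] by (intro prod.cong) auto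
  finally show "(\<Prod>k<d. (y(j := u)) (\<pi> k) (m ! k))
      = u (m ! inv \<pi> j) * (\<Prod>k\<in>{..<d} - {inv \<pi> j}. y (\<pi> k) (m ! k))" .
qed

lemma symmetrized_mon_add:
  assumes "j < d"
  shows "symmetrized_mon d m (y(j := u + v)) = symmetrized_mon d m (y(j := u)) + symmetrized_mon d m (y(j := v))"
  unfolding symmetrized_mon_upd[OF assms]
  by (simp add: add_divide_distrib[symmetric] sum.distrib[symmetric] distrib_right)

text \<open>By symmetry the sum over permutations is the same for every slot. Summed over all
  \<open>d\<close> slots, each permutation contributes the whole product rule expansion of the
  derivative, so a single slot gives the fraction \<open>1 / d\<close> of it.\<close>

lemma symmetrized_mon_one_slot:
  assumes j: "j < d" and m: "length m = d"
  shows "symmetrized_mon d m ((\<lambda>_. y)(j := w)) = dmon m y w / of_nat d"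
proof -
  define \<phi> where "\<phi> k = w (m ! k) * (\<Prod>l\<in>{..<d} - {k}. y (m ! l))" for k
  let ?S = "\<lambda>j. \<Sum>\<pi> | \<pi> permutes {..<d}. \<phi> (\<pi> j)"
  have indep: "?S i = ?S j" if "i < d" for i
  proof -
    have "Transposition.transpose i j permutes {..<d}" using that j by (intro permutes_swap_id) auto
    then have "?S i = (\<Sum>\<pi> | \<pi> permutes {..<d}. \<phi> ((\<pi> \<circ> Transposition.transpose i j) i))"
      by (rule sum_permutations_compose_right)
    then show ?thesis by simp
  qed
  have "of_nat d * ?S j = (\<Sum>i<d. ?S i)" using indep by simp
  also have "\<dots> = (\<Sum>\<pi> | \<pi> permutes {..<d}. \<Sum>i<d. \<phi> (\<pi> i))" by (rule sum.swap)
  also have "\<dots> = (\<Sum>\<pi> | \<pi> permutes {..<d}. dmon m y w)"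
  proof (rule sum.cong[OF refl])
    fix \<pi> assume "\<pi> \<in> {\<pi>. \<pi> permutes {..<d}}"
    then have "(\<Sum>i<d. \<phi> (\<pi> i)) = (\<Sum>i<d. \<phi> i)"
      by (intro sum.reindex_bij_betw) (auto simp: permutes_imp_bij)
    then show "(\<Sum>i<d. \<phi> (\<pi> i)) = dmon m y w" using m by (simp add: \<phi>_def dmon_conv_sum)
  qed
  also have "\<dots> = fact d * dmon m y w" by (simp add: card_permutations[of "{..<d}" d])
  finally have S: "?S j = fact d * dmon m y w / of_nat d" using j by (simp add: field_simps)
  have "symmetrized_mon d m ((\<lambda>_. y)(j := w)) = (\<Sum>\<pi> | \<pi> permutes {..<d}. \<phi> (inv \<pi> j)) / fact d"
    unfolding symmetrized_mon_upd[OF j] \<phi>_def ..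
  also have "(\<Sum>\<pi> | \<pi> permutes {..<d}. \<phi> (inv \<pi> j)) = ?S j"
    by (rule sum_permutations_inverse[symmetric])
  also have "?S j / fact d = dmon m y w / of_nat d" unfolding S by simp
  finally show ?thesis .
qed

lemma term_sum_add: "term_sum (\<lambda>m. h m + h' m) ts i = term_sum h ts i + term_sum h' ts i"
  by (induction ts) (auto simp: algebra_simps)

lemma term_sum_scale: "term_sum (\<lambda>m. r * h m) ts i = r * term_sum h ts i"
  by (induction ts) (auto simp: algebra_simps)

text \<open>The sign turns \<open>pmap ts\<close> into \<open>x - M(x, ..., x)\<close> when all
  monomials have degree \<open>d\<close>, so that the tree recursion carries no signs.\<close>

definition multilinear_form ::
    "nat \<Rightarrow> monomial_term list \<Rightarrow> (nat \<Rightarrow> nat \<Rightarrow> complex) \<Rightarrow> nat \<Rightarrow> complex" where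
  "multilinear_form d ts y i = - term_sum (\<lambda>m. symmetrized_mon d m y) ts i"

lemma multiadditive_multilinear_form: "multiadditive {..<d} (multilinear_form d ts)"
  unfolding multiadditive_def
proof (intro conjI allI impI ballI)
  fix z z' :: "nat \<Rightarrow> nat \<Rightarrow> complex" assume "\<forall>s\<in>{..<d}. z s = z' s"
  then have "symmetrized_mon d m z = symmetrized_mon d m z'" for m
    by (intro symmetrized_mon_cong) auto
  then show "multilinear_form d ts z = multilinear_form d ts z'"
    by (simp add: multilinear_form_def fun_eq_iff)
next
  fix s and z :: "nat \<Rightarrow> nat \<Rightarrow> complex" and u v assume "s \<in> {..<d}"
  then show "multilinear_form d ts (z(s := u + v))
      = multilinear_form d ts (z(s := u)) + multilinear_form d ts (z(s := v))"
    by (auto simp: multilinear_form_def fun_eq_iff symmetrized_mon_add term_sum_add)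
qed

lemma poly_fun_term_sum:
  "(\<And>m. poly_fun co (\<lambda>w. h w m)) \<Longrightarrow> poly_fun co (\<lambda>w. term_sum (h w) ts i)"
proof (induction ts)
  case (Cons t ts)
  obtain j c m where t: "t = (j, c, m)" by (cases t)
  show ?case
    unfolding t term_sum_simps
    by (intro poly_fun_add poly_fun_if poly_fun_mult poly_fun_const Cons)
qed (simp add: poly_fun_const)

lemma poly_fun_divide: "poly_fun co f \<Longrightarrow> poly_fun co (\<lambda>x. f x / c)"
  using poly_fun_mult[OF _ poly_fun_const, of co f "1 / c"] by simp

lemma poly_fun_uminus: "poly_fun co f \<Longrightarrow> poly_fun co (\<lambda>x. - f x)"
  using poly_fun_mult[OF poly_fun_const, of co f "-1"] by simp

lemma poly_fun_tree_eval: "poly_fun_nat (\<lambda>w. tree_eval (multilinear_form d ts) w T i)"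
proof (induction T arbitrary: i)
  case (Nd us)
  show ?case
  proof (cases "us = []")
    case True
    then show ?thesis using poly_fun_coord[of "\<lambda>i x. x i" i] by (simp add: tree_eval.simps)
  next
    case False
    have "poly_fun_nat (\<lambda>w. (if j < length us then tree_eval (multilinear_form d ts) w (us ! j) else 0) i)"
      for j i
      using Nd[OF nth_mem] by (cases "j < length us") (auto simp: poly_fun_const)
    then have "poly_fun_nat (\<lambda>w. multilinear_form d ts
        (\<lambda>j. if j < length us then tree_eval (multilinear_form d ts) w (us ! j) else 0) i)"
      unfolding multilinear_form_def symmetrized_mon_def
      by (intro poly_fun_uminus poly_fun_term_sum poly_fun_divide poly_fun_sum poly_fun_prod)
    then show ?thesis using False by (simp add: tree_eval.simps)
  qed
qed

lemma homogeneous_has_right_inverse: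
  assumes d: "d \<ge> 3"
    and span: "\<And>p. p \<ge> 1 \<Longrightarrow> \<exists>k0. \<forall>k\<ge>k0. one_in_shuffle_span d k p"
    and K: "keller_terms ts" and len: "\<And>i c m. (i, c, m) \<in> set ts \<Longrightarrow> length m = d"
  shows "has_right_inverse ts"
proof -
  let ?M = "multilinear_form d ts"
  \<comment> \<open>\<open>A y\<close> is \<open>M\<close> with \<open>y\<close> in all slots but
    one. Because of the sign in \<open>M\<close>, the derivative of \<open>pmap ts\<close> is the
    identity minus \<open>d\<close> times \<open>A\<close>.\<close>
  define A where "A y w i = - term_sum (\<lambda>m. dmon m y w) ts i / of_nat d" for y w i
  note M = multiadditive_multilinear_form[of d ts]
  have sym: "?M ((\<lambda>_. y)(j := w)) = A y w" if "j < d" for y w j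
  proof
    fix i
    have "term_sum (\<lambda>m. symmetrized_mon d m ((\<lambda>_. y)(j := w))) ts i
        = term_sum (\<lambda>m. 1 / of_nat d * dmon m y w) ts i"
      by (rule term_sum_cong) (use len that in \<open>auto simp: symmetrized_mon_one_slot\<close>)
    then show "?M ((\<lambda>_. y)(j := w)) i = A y w i"
      unfolding multilinear_form_def A_def term_sum_scale by simp
  qed
  have dA: "dmap ts x v i = v i - of_nat d * A x v i" for x v i
    using d by (simp add: dmap_def A_def)
  have A_scale: "A (\<lambda>a. s * x a) v i = s ^ (d - 1) * A x v i" for s x v i
  proof -
    have "term_sum (\<lambda>m. dmon m (\<lambda>a. s * x a) v) ts i = term_sum (\<lambda>m. s ^ (d - 1) * dmon m x v) ts i"
      by (rule term_sum_cong) (use len in \<open>auto simp: dmon_scale\<close>)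
    then show ?thesis by (simp add: A_def term_sum_scale)
  qed
  have lin: "A y (\<lambda>i. u i + r * v i) = (\<lambda>i. A y u i + r * A y v i)" for y u v r
    by (rule ext) (simp add: A_def dmon_linear term_sum_add term_sum_scale diff_divide_distrib)
  have eig: "v = 0" if l: "l \<noteq> 0" "A y v = (\<lambda>i. l * v i)" for y v l
  proof -
    have "d - 1 \<noteq> 0" using d by simp
    \<comment> \<open>Moving the base point from \<open>y\<close> to \<open>s * y\<close> scales
      \<open>A\<close> by \<open>s ^ (d - 1)\<close>, which brings the eigenvalue \<open>l\<close>
      to \<open>1 / d\<close>; the eigenvector then lies in the kernel of the derivative.\<close>
    then obtain s where s: "1 / (of_nat d * l) = s ^ (d - 1)" by (rule exists_complex_root)
    have "dmap ts (\<lambda>a. s * y a) v i = 0" for i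
      unfolding dA A_scale l(2) s[symmetric] using d l(1) by simp
    then have "v i = 0" for i using K unfolding keller_terms_def by blast
    then show ?thesis by (simp add: fun_eq_iff)
  qed
  \<comment> \<open>All values of \<open>A y\<close> are supported on the targets, so this exponent
    works for every \<open>y\<close> at once; the successor also secures
    \<open>p >= 1\<close>.\<close>
  define p where "p = Suc (card (targets ts))"
  have nil: "(A y ^^ p) w = 0" for y w
    unfolding p_def
  proof (rule nilpotent_of_no_eigenvalue[where A = "A y", OF lin eig])
    show "finite (targets ts)" by (simp add: targets_def)
    show "A y v i = 0" if "i \<notin> targets ts" for v i
      using that by (simp add: A_def term_sum_not_target)
  qed
  have "p \<ge> 1" by (simp add: p_def)
  then obtain k0 where k0: "\<And>k. k \<ge> k0 \<Longrightarrow> one_in_shuffle_span d k p" using span by blast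
  \<comment> \<open>All level sums from \<open>k0\<close> on vanish identically in \<open>w\<close>,
    so this finite sum is the whole formal inverse.\<close>
  define G where "G w = (\<Sum>k<k0. level_sum ?M d w k)" for w
  have "level_sum ?M d w k = 0" if "k \<ge> k0" for w k
    using level_sum_zero[OF M sym nil k0[OF that]] by (simp add: level_sum_def fun_eq_iff sum_fun_apply)
  then have fix_G: "w + ?M (\<lambda>_. G w) = G w" for w
    unfolding G_def using level_sum_fixpoint[OF M] d by simp
  have "pmap ts (G w) i = w i" for w i
  proof -
    have "term_sum (\<lambda>m. symmetrized_mon d m (\<lambda>_. G w)) ts i = term_sum (\<lambda>m. mon m (G w)) ts i"
      by (rule term_sum_cong) (use len in \<open>auto simp: symmetrized_mon_diag\<close>)
    then have "pmap ts (G w) i = G w i - ?M (\<lambda>_. G w) i"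
      by (simp add: pmap_def multilinear_form_def)
    also have "\<dots> = w i" using fun_cong[OF fix_G[of w], of i] by (simp add: algebra_simps)
    finally show ?thesis .
  qed
  moreover have "poly_fun_nat (\<lambda>w. G w i)" for i
    unfolding G_def level_sum_def sum_fun_apply by (intro poly_fun_sum poly_fun_tree_eval)
  ultimately show ?thesis unfolding has_right_inverse_def by blast
qed

subsection \<open>Keller maps on complex vectors\<close>

abbreviation poly_fun_vec :: "(complex ^ 'n \<Rightarrow> complex) \<Rightarrow> bool" where
  "poly_fun_vec \<equiv> poly_fun (\<lambda>i x. x $ i)"

section \<open>Agreement of the two notions of polynomial function\<close>

lemma cpoly_fun_imp_poly_fun:
  assumes "cpoly_fun f"
  shows "poly_fun_vec f"
proof -
  obtain A c where "finite A" and f: "\<And>x. f x = (\<Sum>\<alpha>\<in>A. c \<alpha> * (\<Prod>i\<in>UNIV. (x $ i) ^ (\<alpha> $ i)))"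
    using assms unfolding cpoly_fun_def by blast
  have "poly_fun_vec (\<lambda>x. \<Sum>\<alpha>\<in>A. c \<alpha> * (\<Prod>i\<in>UNIV. (x $ i) ^ (\<alpha> $ i)))"
    by (intro poly_fun_sum poly_fun_mult poly_fun_const poly_fun_prod poly_fun_power poly_fun_coord)
  then show ?thesis using f by presburger
qed

lemma poly_fun_imp_cpoly_fun:
  fixes f :: "complex ^ 'n \<Rightarrow> complex"
  assumes "poly_fun_vec f"
  shows "cpoly_fun f"
  using assms
proof induction
  case (poly_fun_const c)
  show ?case
    unfolding cpoly_fun_def by (rule exI[of _ "{0}"], rule exI[of _ "\<lambda>_. c"]) simp
next
  case (poly_fun_coord i)
  have "(\<Prod>j\<in>UNIV. (x $ j) ^ (axis i 1 $ j)) = x $ i" for x :: "complex ^ 'n"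
  proof -
    have "(\<Prod>j\<in>UNIV. (x $ j) ^ (axis i 1 $ j)) = (\<Prod>j\<in>UNIV. if j = i then x $ j else 1)"
      by (rule prod.cong) (auto simp: axis_def)
    then show ?thesis by simp
  qed
  then show ?case
    unfolding cpoly_fun_def by (intro exI[of _ "{axis i 1}"] exI[of _ "\<lambda>_. 1"]) simp
next
  case (poly_fun_add f g)
  then obtain A B c e where A: "finite A" "\<And>x. f x = (\<Sum>\<alpha>\<in>A. c \<alpha> * (\<Prod>i\<in>UNIV. (x $ i) ^ (\<alpha> $ i)))"
    and B: "finite B" "\<And>x. g x = (\<Sum>\<alpha>\<in>B. e \<alpha> * (\<Prod>i\<in>UNIV. (x $ i) ^ (\<alpha> $ i)))"
    unfolding cpoly_fun_def by blast
  let ?m = "\<lambda>\<alpha> x. \<Prod>i\<in>UNIV. (x $ i :: complex) ^ (\<alpha> $ i)"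
  let ?c = "\<lambda>\<alpha>. (if \<alpha> \<in> A then c \<alpha> else 0) + (if \<alpha> \<in> B then e \<alpha> else 0)"
  have "f x + g x = (\<Sum>\<alpha>\<in>A \<union> B. ?c \<alpha> * ?m \<alpha> x)" for x
  proof -
    have "f x = (\<Sum>\<alpha>\<in>A \<union> B. (if \<alpha> \<in> A then c \<alpha> else 0) * ?m \<alpha> x)"
      unfolding A(2) using A(1) B(1) by (intro sum.mono_neutral_cong_left) auto
    moreover have "g x = (\<Sum>\<alpha>\<in>A \<union> B. (if \<alpha> \<in> B then e \<alpha> else 0) * ?m \<alpha> x)"
      unfolding B(2) using A(1) B(1) by (intro sum.mono_neutral_cong_left) auto
    ultimately show ?thesis by (simp add: sum.distrib[symmetric] distrib_right)
  qed
  then show ?case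
    unfolding cpoly_fun_def using A(1) B(1) by (intro exI[of _ "A \<union> B"] exI[of _ ?c]) auto
next
  case (poly_fun_mult f g)
  then obtain A B c e where A: "finite A" "\<And>x. f x = (\<Sum>\<alpha>\<in>A. c \<alpha> * (\<Prod>i\<in>UNIV. (x $ i) ^ (\<alpha> $ i)))"
    and B: "finite B" "\<And>x. g x = (\<Sum>\<alpha>\<in>B. e \<alpha> * (\<Prod>i\<in>UNIV. (x $ i) ^ (\<alpha> $ i)))"
    unfolding cpoly_fun_def by blast
  let ?m = "\<lambda>\<alpha> x. \<Prod>i\<in>UNIV. (x $ i :: complex) ^ (\<alpha> $ i)"
  let ?add = "\<lambda>(\<alpha>, \<beta>). \<alpha> + \<beta> :: nat ^ 'n"
  \<comment> \<open>Different pairs of exponents may have the same sum, so the coefficient of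
    \<open>\<gamma>\<close> collects the whole fibre of the addition.\<close>
  let ?c = "\<lambda>\<gamma>. \<Sum>p | p \<in> A \<times> B \<and> ?add p = \<gamma>. c (fst p) * e (snd p)"
  have m: "?m (\<alpha> + \<beta>) x = ?m \<alpha> x * ?m \<beta> x" for \<alpha> \<beta> :: "nat ^ 'n" and x
    by (simp add: power_add prod.distrib)
  have "f x * g x = (\<Sum>\<gamma>\<in>?add ` (A \<times> B). ?c \<gamma> * ?m \<gamma> x)" for x
  proof -
    have "f x * g x = (\<Sum>p\<in>A \<times> B. c (fst p) * e (snd p) * ?m (?add p) x)"
      unfolding A(2) B(2) sum_product sum.cartesian_product
      by (rule sum.cong) (auto simp: power_add prod.distrib mult_ac)
    also have "\<dots> = (\<Sum>\<gamma>\<in>?add ` (A \<times> B). \<Sum>p | p \<in> A \<times> B \<and> ?add p = \<gamma>.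
        c (fst p) * e (snd p) * ?m (?add p) x)"
      using A(1) B(1) by (intro sum.image_gen) auto
    also have "\<dots> = (\<Sum>\<gamma>\<in>?add ` (A \<times> B). ?c \<gamma> * ?m \<gamma> x)"
      unfolding sum_distrib_right by (intro sum.cong) auto
    finally show ?thesis .
  qed
  then show ?case
    unfolding cpoly_fun_def using A(1) B(1) by (intro exI[of _ "?add ` (A \<times> B)"] exI[of _ ?c]) auto
qed

section \<open>Derivatives and the Jacobian matrix\<close>

lemma poly_fun_vec_has_derivative:
  fixes f :: "complex ^ 'n \<Rightarrow> complex"
  assumes "poly_fun_vec f"
  shows "\<exists>g. (f has_derivative (\<lambda>v. \<Sum>j\<in>UNIV. g j * v $ j)) (at x)"
  using assms
proof induction
  case (poly_fun_const c)
  show ?case by (rule exI[of _ "\<lambda>_. 0"]) simp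
next
  case (poly_fun_coord i)
  have "(\<Sum>j\<in>UNIV. (if j = i then 1 else 0) * v $ j) = v $ i" for v :: "complex ^ 'n"
    by (simp add: if_distrib[of "\<lambda>c. c * _"] cong: if_cong)
  moreover have "((\<lambda>x. x $ i) has_derivative (\<lambda>v. v $ i)) (at x)"
    by (rule bounded_linear_imp_has_derivative) (rule bounded_linear_vec_nth)
  ultimately show ?case by (intro exI[of _ "\<lambda>j. if j = i then 1 else 0"]) simp
next
  case (poly_fun_add f g)
  then obtain a b where "(f has_derivative (\<lambda>v. \<Sum>j\<in>UNIV. a j * v $ j)) (at x)"
    "(g has_derivative (\<lambda>v. \<Sum>j\<in>UNIV. b j * v $ j)) (at x)" by blast
  from has_derivative_add[OF this]
  have "((\<lambda>x. f x + g x) has_derivative (\<lambda>v. \<Sum>j\<in>UNIV. (a j + b j) * v $ j)) (at x)"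
    by (simp add: sum.distrib distrib_right)
  then show ?case by (rule exI[of _ "\<lambda>j. a j + b j"])
next
  case (poly_fun_mult f g)
  then obtain a b where "(f has_derivative (\<lambda>v. \<Sum>j\<in>UNIV. a j * v $ j)) (at x)"
    "(g has_derivative (\<lambda>v. \<Sum>j\<in>UNIV. b j * v $ j)) (at x)" by blast
  from has_derivative_mult[OF this]
  have "((\<lambda>x. f x * g x) has_derivative (\<lambda>v. \<Sum>j\<in>UNIV. (f x * b j + a j * g x) * v $ j)) (at x)"
    by (simp add: sum.distrib sum_distrib_left sum_distrib_right algebra_simps)
  then show ?case by (rule exI[of _ "\<lambda>j. f x * b j + a j * g x"])
qed

text \<open>Basis vectors of the target have the form \<open>axis i e\<close>, so the inner product
  with one of them sees component \<open>i\<close> alone.\<close>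

lemma has_derivative_vec_componentwise:
  fixes F :: "'a::real_normed_vector \<Rightarrow> complex ^ 'n"
  assumes "\<And>i. ((\<lambda>x. F x $ i) has_derivative (\<lambda>v. D v $ i)) (at x)"
  shows "(F has_derivative D) (at x)"
proof (subst has_derivative_componentwise_within, rule ballI)
  fix b :: "complex ^ 'n" assume "b \<in> Basis"
  then obtain i e where b: "b = axis i e" by (auto simp: Basis_vec_def)
  have "((\<lambda>x. F x $ i \<bullet> e) has_derivative (\<lambda>v. D v $ i \<bullet> e)) (at x)"
    by (rule has_derivative_inner_left[OF assms])
  then show "((\<lambda>x. F x \<bullet> b) has_derivative (\<lambda>v. D v \<bullet> b)) (at x)"
    by (simp add: b inner_axis)
qed

text \<open>Each component has some complex linear form as its derivative; restriction to the
  \<open>j\<close>-th coordinate line identifies its \<open>j\<close>-th coefficient with the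
  partial derivative in \<open>jacobian\<close>.\<close>

lemma poly_map_has_derivative:
  assumes "poly_map F"
  shows "(F has_derivative (\<lambda>v. jacobian F x *v v)) (at x)"
proof (rule has_derivative_vec_componentwise)
  fix i
  obtain g where g: "((\<lambda>x. F x $ i) has_derivative (\<lambda>v. \<Sum>j\<in>UNIV. g j * v $ j)) (at x)"
    using poly_fun_vec_has_derivative cpoly_fun_imp_poly_fun assms unfolding poly_map_def by blast
  have "jacobian F x $ i $ j = g j" for j
  proof -
    let ?c = "\<lambda>t. \<chi> k. if k = j then t else x $ k"
    have cx: "?c (x $ j) = x" by (simp add: vec_eq_iff)
    have "(?c has_derivative (\<lambda>t. axis j t)) (at (x $ j))"
    proof (rule has_derivative_vec_componentwise)
      fix k
      show "((\<lambda>t. ?c t $ k) has_derivative (\<lambda>t. axis j t $ k)) (at (x $ j))"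
        by (cases "k = j") (auto simp: axis_def)
    qed
    from has_derivative_compose[OF this] g
    have "((\<lambda>t. F (?c t) $ i) has_derivative (\<lambda>t. \<Sum>k\<in>UNIV. g k * axis j t $ k)) (at (x $ j))"
      by (simp add: cx)
    moreover have "(\<Sum>k\<in>UNIV. g k * axis j t $ k) = g j * t" for t
      by (simp add: axis_def if_distrib[of "\<lambda>c. _ * c"] cong: if_cong)
    ultimately have "((\<lambda>t. F (?c t) $ i) has_field_derivative g j) (at (x $ j))"
      by (simp add: has_field_derivative_def)
    then show ?thesis by (simp add: jacobian_def DERIV_imp_deriv)
  qed
  then show "((\<lambda>x. F x $ i) has_derivative (\<lambda>v. (jacobian F x *v v) $ i)) (at x)"
    using g by (simp add: matrix_vector_mult_def)
qed

text \<open>By the chain rule the Jacobians of \<open>F\<close> at \<open>G x\<close> and of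
  \<open>G\<close> at \<open>x\<close> multiply to the identity, so their determinants are
  reciprocal constants.\<close>

lemma keller_map_right_inverse:
  assumes F: "keller_map F" and G: "poly_map G" and FG: "F \<circ> G = id"
  shows "keller_map G"
proof -
  obtain c where c: "c \<noteq> 0" "\<And>x. det (jacobian F x) = c" and "poly_map F"
    using F unfolding keller_map_def by blast
  have "det (jacobian G x) = 1 / c" for x
  proof -
    have "(F \<circ> G has_derivative (\<lambda>v. jacobian F (G x) *v v) \<circ> (\<lambda>v. jacobian G x *v v)) (at x)"
      by (rule diff_chain_at[OF poly_map_has_derivative[OF G] poly_map_has_derivative[OF \<open>poly_map F\<close>]])
    then have "(id has_derivative (\<lambda>v. (jacobian F (G x) ** jacobian G x) *v v)) (at x)"
      unfolding FG by (simp add: comp_def matrix_vector_mul_assoc)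
    then have "(\<lambda>v. (jacobian F (G x) ** jacobian G x) *v v) = (\<lambda>v. v)"
      by (rule has_derivative_unique) (simp add: id_def)
    then have "jacobian F (G x) ** jacobian G x = mat 1"
      unfolding matrix_eq by (metis matrix_vector_mul_lid)
    then have "det (jacobian F (G x)) * det (jacobian G x) = 1" by (metis det_mul det_I)
    then show ?thesis using c by (simp add: field_simps)
  qed
  then show ?thesis unfolding keller_map_def using G c by (intro conjI exI[of _ "1 / c"]) auto
qed

section \<open>Normalisation at the origin\<close>

lemma mon_low_order:
  "mon m (\<lambda>_. 0) + dmon m (\<lambda>_. 0) x = (if length m < 2 then mon m x else 0)"
  by (cases m rule: list.exhaust[case_product list.exhaust[of "tl m"]]) auto

lemma second_order_monomials:
  assumes "poly_fun_nat g" "g (\<lambda>_. 0) = 0"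
    and "\<And>v. ((\<lambda>t. g (\<lambda>a. t * v a)) has_field_derivative 0) (at 0)"
  obtains l where "\<And>c m. (c, m) \<in> set l \<Longrightarrow> length m \<ge> 2" "\<And>x. g x = (\<Sum>(c, m)\<leftarrow>l. c * mon m x)"
proof -
  obtain l where l: "\<And>x. g x = (\<Sum>(c, m)\<leftarrow>l. c * mon m x)"
    using poly_fun_nat_monomials[OF assms(1)] by blast
  let ?l = "filter (\<lambda>(c, m). length m \<ge> 2) l"
  have "((\<lambda>t. \<Sum>(c, m)\<leftarrow>l. c * mon m (\<lambda>a. 0 + t * v a)) has_field_derivative
      (\<Sum>(c, m)\<leftarrow>l. c * dmon m (\<lambda>_. 0) v)) (at 0)" for v
  proof (induction l)
    case (Cons p l)
    then show ?case
      by (cases p) (auto intro!: DERIV_add DERIV_cmult simp: mon_has_derivative[of _ "\<lambda>_. 0", simplified])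
  qed simp
  then have d0: "(\<Sum>(c, m)\<leftarrow>l. c * dmon m (\<lambda>_. 0) v) = 0" for v
    using assms(3)[of v] DERIV_unique unfolding l by fastforce
  have split: "(\<Sum>(c, m)\<leftarrow>l. c * mon m x) = (\<Sum>(c, m)\<leftarrow>?l. c * mon m x)
      + ((\<Sum>(c, m)\<leftarrow>l. c * mon m (\<lambda>_. 0)) + (\<Sum>(c, m)\<leftarrow>l. c * dmon m (\<lambda>_. 0) x))" for x
  proof (induction l)
    case (Cons p l)
    obtain c m where p: "p = (c, m)" by (cases p)
    have "c * mon m (\<lambda>_. 0) + c * dmon m (\<lambda>_. 0) x = (if length m < 2 then c * mon m x else 0)"
      using mon_low_order[of m x] by (metis distrib_left mult_zero_right)
    then show ?case using Cons by (auto simp: p algebra_simps split: if_splits)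
  qed simp
  have "g x = (\<Sum>(c, m)\<leftarrow>?l. c * mon m x)" for x
    using split[of x] d0[of x] assms(2) unfolding l by simp
  then show ?thesis using that[of ?l] by auto
qed

lemma term_sum_concat:
  assumes "inj \<iota>" "distinct es"
  shows "term_sum h (concat (map (\<lambda>i. map (\<lambda>(c, m). (\<iota> i, c, m)) (l i)) es)) (\<iota> i)
    = (if i \<in> set es then \<Sum>(c, m)\<leftarrow>l i. c * h m else 0)"
  using assms(2)
proof (induction es)
  case (Cons j es)
  have "term_sum h (map (\<lambda>(c, m). (\<iota> j, c, m)) l') (\<iota> i) = (if i = j then \<Sum>(c, m)\<leftarrow>l'. c * h m else 0)"
    for l'
    using inj_eq[OF assms(1)] by (induction l') auto
  then show ?case using Cons by auto
qed simp

text \<open>Applying the inverse \<open>B\<close> of the Jacobian at 0 to \<open>F - F 0\<close>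
  gives the identity plus terms of order at least two. An injection \<open>\<iota>\<close> of the
  index type into the naturals turns these into a list of terms, and a right inverse for the list is
  transported back through the same affine change.\<close>

lemma keller_map_has_right_inverse:
  fixes F :: "complex ^ 'n \<Rightarrow> complex ^ 'n"
  assumes terms: "\<And>ts. keller_terms ts \<Longrightarrow> (\<And>i c m. (i, c, m) \<in> set ts \<Longrightarrow> length m \<ge> 2)
      \<Longrightarrow> has_right_inverse ts"
    and F: "keller_map F"
  shows "\<exists>G. poly_map G \<and> F \<circ> G = id"
proof -
  obtain c0 where c0: "c0 \<noteq> 0" "\<And>x. det (jacobian F x) = c0" and pF: "poly_map F"
    using F unfolding keller_map_def by blast
  have inv: "matrix_inv (jacobian F x) ** jacobian F x = mat 1 \<and> jacobian F x ** matrix_inv (jacobian F x) = mat 1"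
    for x
  proof -
    have "invertible (jacobian F x)" using c0 by (simp add: invertible_det_nz)
    then show ?thesis unfolding invertible_def matrix_inv_def by (rule someI2_ex) auto
  qed
  define B where "B = matrix_inv (jacobian F 0)"
  have B_inj: "u = v" if "B *v u = B *v v" for u v
  proof -
    have "jacobian F 0 *v (B *v u) = jacobian F 0 *v (B *v v)" using that by simp
    then show ?thesis using inv[of 0] by (simp add: matrix_vector_mul_assoc B_def)
  qed
  obtain \<iota> :: "'n \<Rightarrow> nat" where \<iota>: "inj \<iota>"
    using finite_imp_inj_to_nat_seg[of "UNIV :: 'n set"] by auto
  \<comment> \<open>\<open>hat\<close> reads a vector off a sequence; \<open>g\<close>, defined
    next, is the deviation of the normalised map from the identity.\<close>
  define hat :: "(nat \<Rightarrow> complex) \<Rightarrow> complex ^ 'n" where "hat x = (\<chi> j. x (\<iota> j))" for x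
  define g where "g i x = (B *v (F (hat x) - F 0)) $ i - x (\<iota> i)" for i x
  have poly_g: "poly_fun_nat (g i)" for i
  proof -
    have "poly_fun_nat (\<lambda>x. F (hat x) $ j)" for j
    proof (rule poly_fun_subst[of "\<lambda>i x. x $ i" "\<lambda>x. F x $ j" _ hat])
      show "poly_fun_vec (\<lambda>x. F x $ j)"
        using pF cpoly_fun_imp_poly_fun unfolding poly_map_def by blast
      show "poly_fun_nat (\<lambda>w. hat w $ i)" for i
        using poly_fun_coord[of "\<lambda>i x. x i" "\<iota> i"] by (simp add: hat_def)
    qed
    then have "poly_fun_nat (\<lambda>x. (\<Sum>j\<in>UNIV. B $ i $ j * (F (hat x) $ j + (- F 0 $ j))) + (-1) * x (\<iota> i))"
      by (intro poly_fun_add poly_fun_sum poly_fun_mult poly_fun_const poly_fun_coord)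
    moreover have "g i = (\<lambda>x. (\<Sum>j\<in>UNIV. B $ i $ j * (F (hat x) $ j + (- F 0 $ j))) + (-1) * x (\<iota> i))"
      by (simp add: fun_eq_iff g_def matrix_vector_mult_def)
    ultimately show ?thesis by simp
  qed
  have hat_line: "hat (\<lambda>a. x a + t * v a) = hat x + t *s hat v" for x v t
    by (simp add: vec_eq_iff hat_def)
  have hat0: "hat (\<lambda>_. 0) = 0" by (simp add: vec_eq_iff hat_def)
  have deriv_g: "((\<lambda>t. g i (\<lambda>a. x a + t * v a)) has_field_derivative
      ((B *v (jacobian F (hat x) *v hat v)) $ i - v (\<iota> i))) (at 0)" for i x v
  proof -
    let ?J = "jacobian F (hat x)"
    have line: "((\<lambda>t. hat x + t *s hat v) has_derivative (\<lambda>t. t *s hat v)) (at 0)"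
      by (rule has_derivative_vec_componentwise) (auto intro!: derivative_eq_intros)
    have "((\<lambda>t. F (hat x + t *s hat v)) has_derivative (\<lambda>t. ?J *v (t *s hat v))) (at 0)"
      using has_derivative_compose[OF line, of F "\<lambda>v. ?J *v v"] poly_map_has_derivative[OF pF, of "hat x"]
      by simp
    then have "((\<lambda>t. F (hat x + t *s hat v) $ j) has_derivative (\<lambda>t. (?J *v (t *s hat v)) $ j)) (at 0)" for j
      by (rule bounded_linear.has_derivative[OF bounded_linear_vec_nth])
    moreover have "(?J *v (t *s hat v)) $ j = (?J *v hat v) $ j * t" for j t
      by (simp add: matrix_vector_mult_def sum_distrib_left mult_ac)
    ultimately have Fj: "((\<lambda>t. F (hat x + t *s hat v) $ j) has_field_derivative (?J *v hat v) $ j) (at 0)" for j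
      by (simp only: has_field_derivative_def)
    show ?thesis
      unfolding g_def hat_line
      by (auto simp: matrix_vector_mult_def[of B] mult.commute intro!: derivative_eq_intros Fj)
  qed
  have ex_l: "\<exists>l. (\<forall>c m. (c, m) \<in> set l \<longrightarrow> length m \<ge> 2) \<and> (\<forall>x. g i x = (\<Sum>(c, m)\<leftarrow>l. c * mon m x))" for i
  proof (rule second_order_monomials[OF poly_g])
    show "g i (\<lambda>_. 0) = 0" by (simp add: g_def hat0)
    fix v
    have "(B *v (jacobian F 0 *v hat v)) $ i - v (\<iota> i) = 0"
      using inv[of 0] by (simp add: B_def matrix_vector_mul_assoc hat_def)
    then show "((\<lambda>t. g i (\<lambda>a. t * v a)) has_field_derivative 0) (at 0)"
      using deriv_g[of i "\<lambda>_. 0" v] by (simp add: hat0)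
  qed blast
  have "\<exists>l. \<forall>i. (\<forall>c m. (c, m) \<in> set (l i) \<longrightarrow> length m \<ge> 2) \<and> (\<forall>x. g i x = (\<Sum>(c, m)\<leftarrow>l i. c * mon m x))"
    by (rule choice, rule allI, rule ex_l)
  then obtain l where l2: "\<And>i c m. (c, m) \<in> set (l i) \<Longrightarrow> length m \<ge> 2"
    and l: "\<And>i x. g i x = (\<Sum>(c, m)\<leftarrow>l i. c * mon m x)"
    by blast
  obtain es :: "'n list" where es: "set es = UNIV" "distinct es"
    using finite_distinct_list[of "UNIV :: 'n set"] by auto
  define ts where "ts = concat (map (\<lambda>i. map (\<lambda>(c, m). (\<iota> i, c, m)) (l i)) es)"
  have ts_sum: "term_sum h ts (\<iota> i) = (\<Sum>(c, m)\<leftarrow>l i. c * h m)" for h i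
    unfolding ts_def using term_sum_concat[OF \<iota> es(2)] es(1) by simp
  have pmap_ts: "pmap ts x (\<iota> i) = (B *v (F (hat x) - F 0)) $ i" for x i
    unfolding pmap_def ts_sum l[symmetric] by (simp add: g_def)
  have dmap_ts: "dmap ts x v (\<iota> i) = (B *v (jacobian F (hat x) *v hat v)) $ i" for x v i
  proof -
    \<comment> \<open>The formal and the analytic derivative of \<open>g i\<close> along the line
      through \<open>x\<close> in direction \<open>v\<close> are identified by uniqueness of
      derivatives.\<close>
    have "((\<lambda>t. \<Sum>(c, m)\<leftarrow>l'. c * mon m (\<lambda>a. x a + t * v a)) has_field_derivative
        (\<Sum>(c, m)\<leftarrow>l'. c * dmon m x v)) (at 0)" for l'
    proof (induction l')
      case (Cons p l')
      then show ?case by (cases p) (auto intro!: DERIV_add DERIV_cmult mon_has_derivative)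
    qed simp
    from DERIV_unique[OF this deriv_g[of i x v, unfolded l]]
    show ?thesis unfolding dmap_def ts_sum by simp
  qed
  have targets: "targets ts \<subseteq> range \<iota>" by (auto simp: targets_def ts_def)
  have "keller_terms ts"
    unfolding keller_terms_def
  proof (intro allI impI)
    fix x v n assume 0: "\<forall>i. dmap ts x v i = 0"
    have "B *v (jacobian F (hat x) *v hat v) = B *v 0"
      using 0 dmap_ts[of x v] by (simp add: vec_eq_iff)
    then have "jacobian F (hat x) *v hat v = 0" by (rule B_inj)
    then have "matrix_inv (jacobian F (hat x)) *v (jacobian F (hat x) *v hat v) = 0" by simp
    then have "hat v = 0" using inv[of "hat x"] by (simp add: matrix_vector_mul_assoc)
    then have v: "v (\<iota> i) = 0" for i by (simp add: hat_def vec_eq_iff)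
    show "v n = 0"
    proof (cases "n \<in> range \<iota>")
      case False
      then have "n \<notin> targets ts" using targets by auto
      then show ?thesis using 0[rule_format, of n] by (simp add: dmap_def term_sum_not_target)
    qed (use v in auto)
  qed
  moreover have "length m \<ge> 2" if "(i, c, m) \<in> set ts" for i c m
    using that l2 by (auto simp: ts_def)
  ultimately have "has_right_inverse ts" by (rule terms)
  then obtain G where G: "\<And>i. poly_fun_nat (\<lambda>w. G w i)" "\<And>w i. pmap ts (G w) i = w i"
    unfolding has_right_inverse_def by blast
  \<comment> \<open>The prescribed value \<open>u\<close> undergoes the same normalisation as
    \<open>F\<close>, with 0 in the coordinates outside the range of \<open>\<iota>\<close>.\<close>
  define W where "W u n = (if n \<in> range \<iota> then (B *v (u - F 0)) $ (inv_into UNIV \<iota> n) else 0)" for u n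
  have W: "W u (\<iota> i) = (B *v (u - F 0)) $ i" for u i using \<iota> by (simp add: W_def)
  have poly_W: "poly_fun_vec (\<lambda>u. W u n)" for n
  proof -
    have "poly_fun_vec (\<lambda>u. if n \<in> range \<iota>
        then \<Sum>j\<in>UNIV. B $ (inv_into UNIV \<iota> n) $ j * (u $ j + (- F 0 $ j)) else 0)"
      by (intro poly_fun_if poly_fun_add poly_fun_sum poly_fun_mult poly_fun_const poly_fun_coord)
    then show ?thesis by (simp add: W_def matrix_vector_mult_def cong: if_cong)
  qed
  define G' where "G' u = hat (G (W u))" for u
  have "poly_map G'"
    unfolding poly_map_def
  proof
    fix i
    have "poly_fun_vec (\<lambda>u. G (W u) (\<iota> i))"
      by (rule poly_fun_subst[OF G(1)]) (rule poly_W)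
    then show "cpoly_fun (\<lambda>u. G' u $ i)"
      by (intro poly_fun_imp_cpoly_fun) (simp add: G'_def hat_def)
  qed
  moreover have "F (G' u) = u" for u
  proof -
    have "B *v (F (G' u) - F 0) = B *v (u - F 0)"
      using pmap_ts[of "G (W u)"] by (simp add: vec_eq_iff G'_def G(2) W)
    then have "F (G' u) - F 0 = u - F 0" by (rule B_inj)
    then show ?thesis by simp
  qed
  ultimately show ?thesis by (intro exI[of _ G']) (auto simp: fun_eq_iff)
qed

theorem theorem1p4:
  fixes F :: "complex ^ 'n \<Rightarrow> complex ^ 'n"
  assumes "\<exists>d::nat. d \<ge> 3 \<and>
             (\<forall>p::nat. p \<ge> 1 \<longrightarrow> (\<exists>k0::nat. \<forall>k\<ge>k0. one_in_shuffle_span d k p))"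
    and "keller_map F"
  shows "poly_automorphism F"
proof -
  obtain d where d: "d \<ge> 3" "\<And>p. p \<ge> 1 \<Longrightarrow> \<exists>k0. \<forall>k\<ge>k0. one_in_shuffle_span d k p"
    using assms(1) by blast
  have right: "\<exists>G. poly_map G \<and> F \<circ> G = id" if "keller_map F" for F :: "complex ^ 'n \<Rightarrow> complex ^ 'n"
    by (rule keller_map_has_right_inverse[OF reduce_to_homogeneous[OF
          homogeneous_has_right_inverse[OF d] d(1)] that])
  obtain G where G: "poly_map G" "F \<circ> G = id" using right[OF assms(2)] by blast
  then have "keller_map G" using keller_map_right_inverse[OF assms(2)] by blast
  then obtain K where K: "G \<circ> K = id" using right by blast
  \<comment> \<open>Associativity gives \<open>F = K\<close>, so the right inverse \<open>G\<close>
    is also a left inverse.\<close>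
  have "F = (F \<circ> G) \<circ> K" using K by (simp add: comp_assoc)
  then have "F = K" using G by simp
  then show ?thesis
    using G K assms(2) unfolding poly_automorphism_def keller_map_def by blast
qed

end
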